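(* There exist an open set $U\subset M$ and a constant $K>0$ depending only on $U$ such that $$|m_y(\chi_U)-\overline m(\chi_U)|\le K\,y^{1/2}|\log y|\qquad\text{for all } 0<y\le 1/2 .$$ Furthermore (for the same $U$), if $\alpha>1/2$, then $$\varlimsup_{y\to 0^+}\Big[\,|m_y(\chi_U)-\overline m(\chi_U)|\,y^{-\alpha}\Big]=\infty .$$
   Context: Let $\mathbb H=\{x+iy: y>0\}$ be the upper half-plane with the hyperbolic metric $(dx^2+dy^2)/y^2$, and let $T_1\mathbb H$ be its unit tangent bundle. A unit tangent vector is written $(z,\theta)$, where $z=x+iy\in\mathbb H$ is the base point and $\theta\in\mathbb R/2\pi\mathbb Z$ is its angle measured counter-clockwise from the upward vertical direction. The group $\mathrm{PSL}(2,\mathbb R)$ acts simply transitively on $T_1\mathbb H$ by differentials of Möbius transformations: for $\sigma(z)=\frac{az+b}{cz+d}$, $\sigma(z,\theta)=(\sigma(z),\theta-2\arg(cz+d))$. $M=\mathrm{PSL}(2,\mathbb R)/\mathrm{PSL}(2,\mathbb Z)$ is identified with the quotient of $T_1\mathbb H$ by this action of $\mathrm{PSL}(2,\mathbb Z)$. $\overline m$ is the normalized Haar measure on $M$, i.e. the probability measure on $M$ proportional to the one induced by $y^{-2}\,dx\,dy\,d\theta$ on $T_1\mathbb H$. For $y>0$, $m_y$ is the Borel probability measure on $M$ uniformly distributed (with respect to arc length) on the closed unstable horocycle orbit of period $1/y$, which is the image in $M$ of $\{((x,y),\pi): 0\le x\le 1\}$; that is, $m_y(f)=\int_0^1 f((x,y),\pi)\,dx$.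 For a measure $\mu$, $\mu(f)$ denotes $\int f\,d\mu$, and $\chi_U$ is the characteristic function of $U$. *)

theory Defs
  imports "HOL-Probability.Probability"
begin

text \<open>
  The unit tangent vector \<open>(z, \<theta>)\<close> of the upper half-plane is encoded as the pair \<open>(z, cis \<theta>)\<close>:
  the map \<open>\<theta> \<mapsto> cis \<theta>\<close> identifies \<open>\<real> / 2\<pi>\<int>\<close> with the unit circle.  As \<open>\<theta>\<close> is measured from the
  upward vertical, the second component is not the direction of the vector itself (which is
  \<open>\<i> * cis \<theta>\<close>).
\<close>

definition T1H :: "(complex \<times> complex) set" where
  "T1H = {(z, u). Im z > 0 \<and> norm u = 1}"

text \<open>The action \<open>(z, \<theta>) \<mapsto> (\<sigma> z, \<theta> - 2 arg (c z + d))\<close>, for \<open>a d - b c = 1\<close>.\<close>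

definition T1H_act :: "real \<Rightarrow> real \<Rightarrow> real \<Rightarrow> real \<Rightarrow> complex \<times> complex \<Rightarrow> complex \<times> complex" where
  "T1H_act a b c d = (\<lambda>(z, u).
     (moebius (of_real a) (of_real b) (of_real c) (of_real d) z,
      u * cis (- 2 * Arg (of_real c * z + of_real d))))"

text \<open>
  A matrix and its negative act in the same way, so the orbits of \<open>PSL(2,\<int>)\<close> are those of
  \<open>SL(2,\<int>)\<close>.
\<close>

definition orbit :: "complex \<times> complex \<Rightarrow> (complex \<times> complex) set" where
  "orbit p = {T1H_act (of_int a) (of_int b) (of_int c) (of_int d) p | a b c d :: int.
                a * d - b * c = 1}"

definition M_space :: "(complex \<times> complex) set set" where
  "M_space = orbit ` T1H"

definition M_top :: "(complex \<times> complex) set topology" where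
  "M_top = topology (\<lambda>U. U \<subseteq> M_space \<and> openin (top_of_set T1H) {p \<in> T1H. orbit p \<in> U})"

definition M_borel :: "(complex \<times> complex) set measure" where
  "M_borel = sigma M_space {U. openin M_top U}"

text \<open>The measure \<open>y\<^sup>-\<^sup>2 dx dy d\<theta>\<close> on the unit tangent bundle.\<close>

definition haar_T1H :: "(complex \<times> complex) measure" where
  "haar_T1H = restrict_space
     (density lborel (\<lambda>z. ennreal (1 / (Im z)\<^sup>2)) \<Otimes>\<^sub>M
      distr (restrict_space lborel {0..<2 * pi}) borel cis) T1H"

text \<open>
  The standard fundamental domain of \<open>PSL(2,\<int>)\<close>; points of its interior lie in distinct orbits,
  and its boundary is a null set.
\<close>

definition fund_dom :: "(complex \<times> complex) set" where
  "fund_dom = {(z, u) \<in> T1H. \<bar>Re z\<bar> \<le> 1/2 \<and> norm z \<ge> 1}"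

definition haar_M :: "(complex \<times> complex) set measure" where
  "haar_M = distr (uniform_measure haar_T1H fund_dom) M_borel orbit"

definition horocycle_measure :: "real \<Rightarrow> (complex \<times> complex) set measure" where
  "horocycle_measure y =
     distr (uniform_measure lborel {0..1}) M_borel (\<lambda>x. orbit (Complex x y, cis pi))"


lemma T1H_act_in_T1H:
  assumes "p \<in> T1H" "a * d - b * c = 1"
  shows "T1H_act a b c d p \<in> T1H"
proof -
  obtain z u where p: "p = (z, u)" by force
  have z: "Im z > 0" and u: "norm u = 1" using assms(1) by (auto simp: T1H_def p)
  have nz: "of_real c * z + of_real d \<noteq> 0"
  proof
    assume *: "of_real c * z + of_real d = 0"
    hence "Im (of_real c * z + of_real d) = 0" "Re (of_real c * z + of_real d) = 0"
      by auto
    thus False using z assms(2) by auto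
  qed
  have "Im (moebius (of_real a) (of_real b) (of_real c) (of_real d) z)
        = (a * d - b * c) * Im z / (norm (of_real c * z + of_real d))\<^sup>2"
    unfolding moebius_def by (simp add: Im_divide cmod_power2 algebra_simps)
  also have "\<dots> > 0" using assms(2) z nz by simp
  finally show ?thesis using u by (simp add: T1H_act_def T1H_def p norm_mult)
qed

lemma T1H_act_mult:
  fixes a b c d a' b' c' d' :: real
  assumes "p \<in> T1H" "a * d - b * c = 1" "a' * d' - b' * c' = 1"
  shows "T1H_act a' b' c' d' (T1H_act a b c d p) =
         T1H_act (a' * a + b' * c) (a' * b + b' * d) (c' * a + d' * c) (c' * b + d' * d) p"
proof -
  obtain z u where p: "p = (z, u)" by force
  define w where "w = of_real c * z + of_real d"
  define v where "v = of_real a * z + of_real b"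
  have z: "Im z > 0" using assms(1) by (auto simp: T1H_def p)
  have nz: "r * z + s \<noteq> 0" if "r = of_real r'" "s = of_real s'" "r' \<noteq> 0 \<or> s' \<noteq> 0" for r s r' s'
    using that z by (auto simp: complex_eq_iff)
  have w: "w \<noteq> 0" unfolding w_def using assms(2) by (intro nz) auto
  have cocycle: "of_real c' * (v / w) + of_real d' =
      (of_real (c' * a + d' * c) * z + of_real (c' * b + d' * d)) / w"
    using w by (simp add: v_def divide_simps) (simp add: w_def algebra_simps)
  have num: "of_real a' * (v / w) + of_real b' =
      (of_real (a' * a + b' * c) * z + of_real (a' * b + b' * d)) / w"
    using w by (simp add: v_def divide_simps) (simp add: w_def algebra_simps)
  define t where "t = of_real (c' * a + d' * c) * z + of_real (c' * b + d' * d)"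
  have cis2: "cis (- 2 * Arg q) = (cnj (sgn q))\<^sup>2" if "q \<noteq> 0" for q
  proof -
    have "cis (- 2 * Arg q) = (cnj (cis (Arg q)))\<^sup>2"
      by (simp add: cis_cnj Complex.DeMoivre)
    thus ?thesis using that by (simp add: cis_Arg)
  qed
  have t: "t \<noteq> 0"
  proof -
    have "(a' * a + b' * c) * (c' * b + d' * d) - (a' * b + b' * d) * (c' * a + d' * c)
          = (a' * d' - b' * c') * (a * d - b * c)" by algebra
    hence "c' * a + d' * c \<noteq> 0 \<or> c' * b + d' * d \<noteq> 0" using assms by auto
    thus ?thesis unfolding t_def by (intro nz) auto
  qed
  have "cis (- 2 * Arg w) * cis (- 2 * Arg (t / w)) = cis (- 2 * Arg t)"
  proof -
    have "sgn w * sgn (t / w) = sgn t" using w by (metis nonzero_mult_div_cancel_left sgn_mult times_divide_eq_right)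
    thus ?thesis using w t cis2[of w] cis2[of t] cis2[of "t/w"]
      by (metis complex_cnj_mult divide_eq_0_iff power_mult_distrib)
  qed
  thus ?thesis
    using w cocycle num
    by (simp add: T1H_act_def p moebius_def t_def mult.assoc
          flip: w_def v_def del: of_real_add of_real_mult)
qed

lemma orbit_eq_iff:
  assumes "p \<in> T1H" "q \<in> T1H"
  shows "orbit p = orbit q \<longleftrightarrow> q \<in> orbit p"
proof -
  have refl: "r \<in> orbit r" for r
    unfolding orbit_def
    by (intro CollectI exI[of _ 1] exI[of _ 0]) (auto simp: T1H_act_def moebius_def split: prod.splits)
  have sub: "orbit s \<subseteq> orbit r" if sr: "s \<in> orbit r" "r \<in> T1H" for r s
  proof
    fix x assume "x \<in> orbit s"
    then obtain a' b' c' d' :: int where x: "a' * d' - b' * c' = 1"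
      "x = T1H_act (of_int a') (of_int b') (of_int c') (of_int d') s"
      by (auto simp: orbit_def)
    obtain a b c d :: int where s: "a * d - b * c = 1"
      "s = T1H_act (of_int a) (of_int b) (of_int c) (of_int d) r"
      using sr(1) unfolding orbit_def by blast
    have "real_of_int (a * d - b * c) = 1" "real_of_int (a' * d' - b' * c') = 1"
      using x(1) s(1) by simp_all
    hence "x = T1H_act (of_int (a' * a + b' * c)) (of_int (a' * b + b' * d))
                 (of_int (c' * a + d' * c)) (of_int (c' * b + d' * d)) r"
      unfolding x(2) s(2) using sr(2) by (subst T1H_act_mult) auto
    moreover have "(a' * a + b' * c) * (c' * b + d' * d) - (a' * b + b' * d) * (c' * a + d' * c)
          = (a' * d' - b' * c') * (a * d - b * c)" by algebra
    ultimately show "x \<in> orbit r" unfolding orbit_def using x(1) s(1)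
      by (metis (mono_tags, lifting) CollectI mult_1)
  qed
  have sym: "p \<in> orbit q" if qp: "q \<in> orbit p"
  proof -
    obtain a b c d :: int where s: "a * d - b * c = 1"
      "q = T1H_act (of_int a) (of_int b) (of_int c) (of_int d) p"
      using qp unfolding orbit_def by blast
    have s': "real_of_int a * real_of_int d - real_of_int b * real_of_int c = 1"
      using s(1) by (metis of_int_1 of_int_diff of_int_mult)
    have "T1H_act (of_int d) (of_int (- b)) (of_int (- c)) (of_int a) q = T1H_act 1 0 0 1 p"
      unfolding s(2) using assms(1) s' by (subst T1H_act_mult) (auto simp: algebra_simps)
    also have "\<dots> = p" by (auto simp: T1H_act_def moebius_def split: prod.splits)
    finally show ?thesis using s(1) unfolding orbit_def
      by (intro CollectI exI[of _ d] exI[of _ "-b"] exI[of _ "-c"] exI[of _ a])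
         (auto simp: algebra_simps)
  qed
  show ?thesis using refl sub sym assms by blast
qed

lemma openin_M_top:
  "openin M_top U \<longleftrightarrow> U \<subseteq> M_space \<and> openin (top_of_set T1H) {p \<in> T1H. orbit p \<in> U}"
proof -
  have "istopology (\<lambda>U. U \<subseteq> M_space \<and> openin (top_of_set T1H) {p \<in> T1H. orbit p \<in> U})"
    unfolding istopology_def
  proof (intro conjI allI impI)
    fix S T
    assume "S \<subseteq> M_space \<and> openin (top_of_set T1H) {p \<in> T1H. orbit p \<in> S}"
      and "T \<subseteq> M_space \<and> openin (top_of_set T1H) {p \<in> T1H. orbit p \<in> T}"
    moreover have "{p \<in> T1H. orbit p \<in> S \<inter> T} = {p \<in> T1H. orbit p \<in> S} \<inter> {p \<in> T1H. orbit p \<in> T}"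
      by auto
    ultimately show "S \<inter> T \<subseteq> M_space" "openin (top_of_set T1H) {p \<in> T1H. orbit p \<in> S \<inter> T}"
      by (auto intro: openin_Int)
  next
    fix K
    assume K: "\<forall>S\<in>K. S \<subseteq> M_space \<and> openin (top_of_set T1H) {p \<in> T1H. orbit p \<in> S}"
    have "{p \<in> T1H. orbit p \<in> \<Union> K} = (\<Union>S\<in>K. {p \<in> T1H. orbit p \<in> S})" by auto
    thus "\<Union> K \<subseteq> M_space" "openin (top_of_set T1H) {p \<in> T1H. orbit p \<in> \<Union> K}"
      using K by auto
  qed
  thus ?thesis by (simp add: M_top_def)
qed

lemma topspace_M_top: "topspace M_top = M_space"
proof -
  have "{p \<in> T1H. orbit p \<in> M_space} = T1H" by (auto simp: M_space_def)
  hence "openin M_top M_space" by (simp add: openin_M_top)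
  thus ?thesis by (meson openin_M_top openin_subset openin_topspace subset_antisym)
qed

lemma quotient_map_orbit: "quotient_map (top_of_set T1H) M_top orbit"
  unfolding quotient_map_def using openin_M_top topspace_M_top
  by (auto simp: M_space_def)

lemma space_M_borel: "space M_borel = M_space"
  and sets_M_borel: "sets M_borel = sigma_sets M_space {U. openin M_top U}"
proof -
  have "{U. openin M_top U} \<subseteq> Pow M_space" by (auto simp: openin_M_top)
  thus "space M_borel = M_space" "sets M_borel = sigma_sets M_space {U. openin M_top U}"
    unfolding M_borel_def by (rule space_measure_of, rule sets_measure_of)
qed

lemma T1H_borel: "T1H \<in> sets borel"
proof -
  have "T1H = {p. Im (fst p) > 0} \<inter> {p. norm (snd p) = 1}" by (auto simp: T1H_def)
  moreover have "open {p::complex \<times> complex. Im (fst p) > 0}"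
    by (intro open_Collect_less continuous_intros)
  moreover have "closed {p::complex \<times> complex. norm (snd p) = 1}"
    by (intro closed_Collect_eq continuous_intros)
  ultimately show ?thesis by (metis borel_closed borel_open sets.Int)
qed

lemma sets_haar_T1H: "sets haar_T1H = sets (restrict_space borel T1H)"
proof -
  have "sets (density lborel (\<lambda>z. ennreal (1 / (Im z)\<^sup>2)) \<Otimes>\<^sub>M
         distr (restrict_space lborel {0..<2 * pi}) borel cis) = sets (borel \<Otimes>\<^sub>M (borel :: complex measure))"
    by (intro sets_pair_measure_cong) auto
  thus ?thesis unfolding haar_T1H_def
    by (intro sets_restrict_space_cong) (simp add: borel_prod[symmetric])
qed

lemma space_haar_T1H: "space haar_T1H = T1H"
  using sets_eq_imp_space_eq[OF sets_haar_T1H] by (simp add: space_restrict_space)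

lemma measurable_orbit: "orbit \<in> haar_T1H \<rightarrow>\<^sub>M M_borel"
proof (rule measurable_sigma_sets[OF sets_M_borel])
  fix U assume "U \<in> {U. openin M_top U}"
  hence "openin (top_of_set T1H) {p \<in> T1H. orbit p \<in> U}" by (simp add: openin_M_top)
  then obtain V where "open V" "{p \<in> T1H. orbit p \<in> U} = T1H \<inter> V" by (auto simp: openin_open)
  hence "{p \<in> T1H. orbit p \<in> U} \<in> sets (restrict_space borel T1H)"
    by (auto simp: sets_restrict_space)
  moreover have "orbit -` U \<inter> space haar_T1H = {p \<in> T1H. orbit p \<in> U}"
    by (auto simp: space_haar_T1H)
  ultimately show "orbit -` U \<inter> space haar_T1H \<in> sets haar_T1H" by (simp add: sets_haar_T1H)
qed (auto simp: openin_M_top space_haar_T1H M_space_def)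

lemma prob_space_horocycle_measure:
  assumes "y > 0"
  shows "prob_space (horocycle_measure y)"
  unfolding horocycle_measure_def
proof (rule prob_space.prob_space_distr)
  show "prob_space (uniform_measure lborel {0..1::real})"
    by (intro prob_space_uniform_measure) auto
  have "(\<lambda>x. (Complex x y, cis pi)) \<in> borel_measurable borel"
    by (intro borel_measurable_continuous_onI continuous_intros)
  hence "(\<lambda>x. (Complex x y, cis pi)) \<in> borel \<rightarrow>\<^sub>M restrict_space borel T1H"
    using assms by (intro measurable_restrict_space2) (auto simp: T1H_def)
  hence "(\<lambda>x. (Complex x y, cis pi)) \<in> uniform_measure lborel {0..1::real} \<rightarrow>\<^sub>M haar_T1H"
    by (simp add: sets_haar_T1H cong: measurable_cong_sets)
  from measurable_compose[OF this measurable_orbit]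
  show "(\<lambda>x. orbit (Complex x y, cis pi)) \<in> uniform_measure lborel {0..1} \<rightarrow>\<^sub>M M_borel" .
qed

lemma emeasure_haar_T1H_Times:
  assumes "A \<in> sets borel" "\<And>z. z \<in> A \<Longrightarrow> Im z > 0"
  shows "emeasure haar_T1H (A \<times> {u. norm u = 1}) =
           (\<integral>\<^sup>+z\<in>A. ennreal (1 / (Im z)\<^sup>2) \<partial>lborel) * ennreal (2 * pi)"
proof -
  let ?L = "density lborel (\<lambda>z::complex. ennreal (1 / (Im z)\<^sup>2))"
  let ?C = "distr (restrict_space lborel {0..<2 * pi}) borel cis"
  have cis: "cis \<in> restrict_space lborel {0..<2 * pi} \<rightarrow>\<^sub>M borel"
  proof (rule measurable_restrict_space1)
    have "continuous_on UNIV cis" by (intro continuous_intros)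
    thus "cis \<in> lborel \<rightarrow>\<^sub>M borel" using borel_measurable_continuous_onI by simp
  qed
  have S: "{u::complex. norm u = 1} \<in> sets borel"
    by (intro borel_closed closed_Collect_eq continuous_intros)
  have C: "emeasure ?C B = emeasure lborel (cis -` B \<inter> {0..<2 * pi})" if "B \<in> sets borel" for B
    using that cis by (simp add: emeasure_distr space_restrict_space emeasure_restrict_space Int_commute)
  interpret C: finite_measure ?C
    by (rule finite_measureI) (auto simp: C emeasure_eq_ennreal_measure)
  have "emeasure haar_T1H (A \<times> {u. norm u = 1}) = emeasure (?L \<Otimes>\<^sub>M ?C) (A \<times> {u. norm u = 1})"
    unfolding haar_T1H_def
  proof (rule emeasure_restrict_space)
    have "sets (?L \<Otimes>\<^sub>M ?C) = sets (borel \<Otimes>\<^sub>M (borel :: complex measure))"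
      by (intro sets_pair_measure_cong) auto
    thus "T1H \<inter> space (?L \<Otimes>\<^sub>M ?C) \<in> sets (?L \<Otimes>\<^sub>M ?C)"
      using T1H_borel by (simp add: space_pair_measure borel_prod[symmetric])
  qed (use assms in \<open>auto simp: T1H_def\<close>)
  also have "\<dots> = emeasure ?L A * emeasure ?C {u. norm u = 1}"
    using assms(1) S by (intro C.emeasure_pair_measure_Times) auto
  also have "emeasure ?C {u. norm u = 1} = ennreal (2 * pi)"
    using S by (subst C) auto
  also have "emeasure ?L A = (\<integral>\<^sup>+z\<in>A. ennreal (1 / (Im z)\<^sup>2) \<partial>lborel)"
    using assms(1) by (subst emeasure_density) auto
  finally show ?thesis .
qed

lemma emeasure_lborel_complex_box:
  assumes "a \<le> b" "c \<le> d"
  shows "emeasure lborel (cbox (Complex a c) (Complex b d)) = ennreal ((b - a) * (d - c))"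
  using assms by (subst emeasure_lborel_cbox) (auto simp: Basis_complex_def)

lemma emeasure_fund_dom:
  "emeasure haar_T1H fund_dom \<noteq> 0" "emeasure haar_T1H fund_dom \<noteq> \<infinity>"
proof -
  let ?A = "{z. Im z > 0} \<inter> {z. \<bar>Re z\<bar> \<le> 1/2 \<and> norm z \<ge> 1}"
  let ?I = "\<lambda>A. \<integral>\<^sup>+z\<in>A. ennreal (1 / (Im z)\<^sup>2) \<partial>lborel"
  have "open {z. Im z > 0}" by (intro open_Collect_less continuous_intros)
  moreover have "closed {z::complex. \<bar>Re z\<bar> \<le> 1/2 \<and> norm z \<ge> 1}"
    by (intro closed_Collect_conj closed_Collect_le continuous_intros)
  ultimately have A: "?A \<in> sets borel" by (intro sets.Int borel_open borel_closed)
  have "fund_dom = ?A \<times> {u. norm u = 1}" by (auto simp: fund_dom_def T1H_def)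
  hence eq: "emeasure haar_T1H fund_dom = ?I ?A * ennreal (2 * pi)"
    using emeasure_haar_T1H_Times[OF A] by (simp only: Int_iff mem_Collect_eq)
  have "ennreal (1/9) = (\<integral>\<^sup>+z. ennreal (1/9) * indicator (cbox (Complex (-1/2) 2) (Complex (1/2) 3)) z \<partial>lborel)"
    by (subst nn_integral_cmult_indicator) (auto simp: emeasure_lborel_complex_box)
  also have "\<dots> \<le> ?I ?A"
  proof (rule nn_integral_mono)
    fix z :: complex
    show "ennreal (1/9) * indicator (cbox (Complex (-1/2) 2) (Complex (1/2) 3)) z
          \<le> ennreal (1 / (Im z)\<^sup>2) * indicator ?A z"
    proof (cases "z \<in> cbox (Complex (-1/2) 2) (Complex (1/2) 3)")
      case True
      hence z: "\<bar>Re z\<bar> \<le> 1/2" "2 \<le> Im z" "Im z \<le> 3" by (auto simp: in_cbox_complex_iff)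
      have "norm z \<ge> 1" using z abs_Im_le_cmod[of z] by linarith
      moreover have "1/9 \<le> 1 / (Im z)\<^sup>2"
        using z power_mono[of "Im z" 3 2] by (simp add: field_simps)
      ultimately show ?thesis using z True by (auto intro!: ennreal_leI)
    qed auto
  qed
  finally have "?I ?A \<noteq> 0" by (auto simp: ennreal_eq_0_iff)
  thus "emeasure haar_T1H fund_dom \<noteq> 0" using pi_gt_zero by (simp add: eq ennreal_eq_0_iff not_le)
  define B where "B = (\<lambda>k::nat. cbox (Complex (-1/2) (2 ^ k / 2)) (Complex (1/2) (2 ^ k)))"
  have sub: "?A \<subseteq> (\<Union>k. B k)"
  proof
    fix z assume z: "z \<in> ?A"
    have "1 \<le> (norm z)\<^sup>2" using z by simp
    hence "1 \<le> (Re z)\<^sup>2 + (Im z)\<^sup>2" by (simp add: cmod_power2)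
    moreover have "(Re z)\<^sup>2 \<le> (1/2)\<^sup>2" by (rule abs_le_square_iff[THEN iffD1]) (use z in simp)
    moreover have "(1/2 :: real)\<^sup>2 = 1/4" by (simp add: power2_eq_square)
    ultimately have "(1/2)\<^sup>2 < (Im z)\<^sup>2" by linarith
    hence half: "1/2 < Im z" by (rule power2_less_imp_less) (use z in simp)
    define k where "k = (LEAST k. Im z \<le> 2 ^ k)"
    obtain n where "Im z < 2 ^ n" using real_arch_pow[of 2 "Im z"] by auto
    hence le: "Im z \<le> 2 ^ k" using LeastI[of "\<lambda>k. Im z \<le> 2 ^ k" n] by (simp add: k_def)
    have "2 ^ k / 2 \<le> Im z"
    proof (cases k)
      case (Suc j)
      hence "\<not> Im z \<le> 2 ^ j" using not_less_Least[of j "\<lambda>k. Im z \<le> 2 ^ k"] by (simp add: k_def)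
      thus ?thesis by (simp add: Suc)
    qed (use half in simp)
    hence "z \<in> B k" using z le by (auto simp: B_def in_cbox_complex_iff)
    thus "z \<in> (\<Union>k. B k)" by blast
  qed
  have IB: "?I (B k) \<le> ennreal (2 * (1/2) ^ k)" for k
  proof -
    have "?I (B k) \<le> (\<integral>\<^sup>+z. ennreal (4 / (2 ^ k)\<^sup>2) * indicator (B k) z \<partial>lborel)"
    proof (rule nn_integral_mono)
      fix z :: complex
      show "ennreal (1 / (Im z)\<^sup>2) * indicator (B k) z \<le> ennreal (4 / (2 ^ k)\<^sup>2) * indicator (B k) z"
      proof (cases "z \<in> B k")
        case True
        hence "2 ^ k / 2 \<le> Im z" by (auto simp: B_def in_cbox_complex_iff)
        moreover have "(2::real) ^ k / 2 > 0" by simp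
        moreover from calculation have "Im z > 0" by (rule less_le_trans[rotated])
        ultimately have "1 / (Im z)\<^sup>2 \<le> 1 / (2 ^ k / 2)\<^sup>2"
          by (intro divide_left_mono power_mono mult_pos_pos zero_less_power) auto
        thus ?thesis using True by (auto simp: power_divide intro!: ennreal_leI)
      qed auto
    qed
    also have "\<dots> = ennreal (4 / (2 ^ k)\<^sup>2) * emeasure lborel (B k)"
      by (subst nn_integral_cmult_indicator) (auto simp: B_def)
    also have "emeasure lborel (B k) = ennreal (2 ^ k / 2)"
      unfolding B_def by (subst emeasure_lborel_complex_box) auto
    also have "ennreal (4 / (2 ^ k)\<^sup>2) * ennreal (2 ^ k / 2) = ennreal (2 * (1/2) ^ k)"
      by (subst ennreal_mult[symmetric]) (auto simp: field_simps power2_eq_square)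
    finally show ?thesis .
  qed
  have Bs: "B k \<in> sets borel" for k by (simp add: B_def)
  have "?I ?A \<le> (\<integral>\<^sup>+z. (\<Sum>k. ennreal (1 / (Im z)\<^sup>2) * indicator (B k) z) \<partial>lborel)"
  proof (rule nn_integral_mono)
    fix z :: complex
    show "ennreal (1 / (Im z)\<^sup>2) * indicator ?A z \<le> (\<Sum>k. ennreal (1 / (Im z)\<^sup>2) * indicator (B k) z)"
    proof (cases "z \<in> ?A")
      case True
      then obtain k where "z \<in> B k" using sub by blast
      hence "ennreal (1 / (Im z)\<^sup>2) * indicator ?A z = (\<Sum>k\<in>{k}. ennreal (1 / (Im z)\<^sup>2) * indicator (B k) z)"
        using True by simp
      also have "\<dots> \<le> (\<Sum>k. ennreal (1 / (Im z)\<^sup>2) * indicator (B k) z)"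
        by (rule sum_le_suminf) auto
      finally show ?thesis .
    qed auto
  qed
  also have "\<dots> = (\<Sum>k. ?I (B k))"
    using Bs by (intro nn_integral_suminf) auto
  also have "\<dots> \<le> (\<Sum>k. ennreal (2 * (1/2) ^ k))"
    using IB by (intro suminf_le) auto
  also have "\<dots> < \<infinity>"
    by (subst suminf_ennreal2) (auto intro!: summable_mult summable_geometric)
  finally have "?I ?A < \<infinity>" .
  thus "emeasure haar_T1H fund_dom \<noteq> \<infinity>"
    by (auto simp: eq ennreal_mult_eq_top_iff)
qed

lemma prob_space_haar_M: "prob_space haar_M"
  unfolding haar_M_def
proof (rule prob_space.prob_space_distr)
  show "prob_space (uniform_measure haar_T1H fund_dom)"
    using emeasure_fund_dom by (rule prob_space_uniform_measure)
  show "orbit \<in> uniform_measure haar_T1H fund_dom \<rightarrow>\<^sub>M M_borel"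
    using measurable_orbit by (simp cong: measurable_cong_sets)
qed

end

theory Submission
  imports Defs "HOL-Number_Theory.Totient" "HOL-Computational_Algebra.Squarefree"
begin

text \<open>
  The open set is chosen so that the time which the horocycle of height \<open>y\<close> spends in it is an
  arithmetic sum. It is the image of a box in the unit tangent bundle with one side along the
  unstable horocycles: the outward normals, at an angle of less than \<open>pi / 2\<close> from the vertical, of the
  circles tangent to the real axis with Euclidean diameter greater than 2. The modular group
  maps the horocycle of height \<open>y\<close> to circles of diameter \<open>1 / (c\<^sup>2 * y)\<close> tangent at the reduced
  fractions with denominator \<open>c\<close>. Hence a point \<open>x\<close> of the horocycle is in the open set exactly if it is
  within \<open>y\<close> of a reduced fraction whose denominator satisfies \<open>2 * c\<^sup>2 * y < 1\<close>
  (\<open>horocycle_in_cusp_set_iff\<close>). These intervals are disjoint, because reduced fractions with such small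
  denominators are more than \<open>2 * y\<close> apart, and so the horocycle measure of the set is
  \<open>2 * y * (\<Sum>c<X. totient c)\<close> with \<open>X = 1 / sqrt (2 * y)\<close> (\<open>horocycle_measure_cusp_set\<close>).

  Both claims are now statements on the summatory function of the totient. By Mertens
  (\<open>totient_sum_asymptotics\<close>) it is \<open>3 / pi\<^sup>2 * X\<^sup>2\<close> up to an error \<open>O(X * ln X)\<close>. The main term
  yields \<open>3 / pi\<^sup>2\<close>, the Haar measure of the set (\<open>haar_M_cusp_set\<close>), and the error
  \<open>O(y powr (1/2) * \<bar>ln y\<bar>)\<close>. This exponent is optimal: when \<open>X\<close> passes from a prime \<open>p\<close> to \<open>p + 1\<close>
  the sum grows by \<open>p - 1\<close>, but the main term only by about \<open>6 / pi\<^sup>2 * p\<close>, so the error is infinitely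
  often at least of order \<open>X\<close> (\<open>horocycle_discrepancy_lower\<close>), that is, of order \<open>y powr (1/2)\<close> after
  normalisation.

  The Haar measure is computed on the standard fundamental domain. There, since the box lies above
  height 1, a vector whose orbit meets the box is itself in the box
  (\<open>orbit_in_cusp_set_fund_dom_iff\<close>), and two explicit integrals remain.
\<close>

section \<open>The summatory function of the totient\<close>

text \<open>
  The number-theoretic Moebius function, real-valued because it only ever weights real sums.
\<close>

definition moebius_mu :: "nat \<Rightarrow> real" where
  "moebius_mu n = (if squarefree n then (-1) ^ card (prime_factors n) else 0)"

lemma abs_moebius_mu_le: "\<bar>moebius_mu n\<bar> \<le> 1"
  by (simp add: moebius_mu_def)

lemma moebius_mu_prime_mult:
  assumes "prime p" "\<not> p dvd d" "squarefree d"
  shows "moebius_mu (p * d) = - moebius_mu d"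
proof -
  have d: "d > 0" using assms(2) by (cases "d = 0") auto
  have "coprime p d" using assms by (simp add: prime_imp_coprime)
  hence "squarefree (p * d)"
    using assms squarefree_prime[of p] by (intro squarefree_mult_coprime) auto
  moreover have "prime_factors (p * d) = insert p (prime_factors d)"
    using assms(1) d by (simp add: prime_factors_product prime_prime_factors)
  moreover have "p \<notin> prime_factors d" using assms(2) by auto
  ultimately show ?thesis using assms(3) by (simp add: moebius_mu_def)
qed

text \<open>
  For a prime \<open>p\<close> dividing \<open>n\<close>, multiplication by \<open>p\<close> pairs the squarefree divisors prime to \<open>p\<close>
  with those divisible by \<open>p\<close>, and \<open>moebius_mu\<close> changes sign along each pair.
\<close>

lemma sum_moebius_mu_divisors:
  assumes "n > 0"
  shows "(\<Sum>d | d dvd n. moebius_mu d) = (if n = 1 then 1 else 0)"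
proof (cases "n = 1")
  case True
  thus ?thesis by (simp add: moebius_mu_def)
next
  case False
  then obtain p where p: "prime p" "p dvd n" using prime_factor_nat by blast
  define A where "A = {d. d dvd n \<and> squarefree d \<and> \<not> p dvd d}"
  have fin: "finite {d. d dvd n}" using assms by simp
  hence finA: "finite A" by (rule rev_finite_subset) (auto simp: A_def)
  have inj: "inj_on ((*) p) A" using p(1) by (auto simp: inj_on_def prime_gt_0_nat)
  have split: "{d. d dvd n \<and> squarefree d} = A \<union> (*) p ` A"
  proof (intro equalityI subsetI)
    fix d assume d: "d \<in> {d. d dvd n \<and> squarefree d}"
    show "d \<in> A \<union> (*) p ` A"
    proof (cases "p dvd d")
      case True
      then obtain e where e: "d = p * e" by blast
      have "\<not> p dvd e"
      proof
        assume "p dvd e"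
        hence "p\<^sup>2 dvd d" unfolding e power2_eq_square by (rule mult_dvd_mono[OF dvd_refl])
        hence "is_unit p" using d unfolding squarefree_def by blast
        thus False using p(1) by (simp add: prime_nat_iff)
      qed
      moreover have "e dvd n" using d e by (metis dvd_mult_right mem_Collect_eq)
      moreover have "squarefree e" using d e squarefree_multD(2) by blast
      ultimately show ?thesis using e by (auto simp: A_def)
    qed (use d in \<open>auto simp: A_def\<close>)
  next
    fix d assume "d \<in> A \<union> (*) p ` A"
    thus "d \<in> {d. d dvd n \<and> squarefree d}"
    proof
      assume "d \<in> (*) p ` A"
      then obtain e where e: "e \<in> A" "d = p * e" by blast
      have cop: "coprime p e" using e p(1) by (auto simp: A_def prime_imp_coprime)
      have "p * e dvd n" using e p(2) cop by (intro divides_mult) (auto simp: A_def)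
      moreover have "squarefree (p * e)" using e squarefree_prime[OF p(1)] cop
        by (intro squarefree_mult_coprime) (auto simp: A_def)
      ultimately show ?thesis using e by simp
    qed (auto simp: A_def)
  qed
  have "(\<Sum>d | d dvd n. moebius_mu d) = (\<Sum>d | d dvd n \<and> squarefree d. moebius_mu d)"
    using fin by (intro sum.mono_neutral_right) (auto simp: moebius_mu_def)
  also have "\<dots> = (\<Sum>d\<in>A. moebius_mu d) + (\<Sum>d\<in>(*) p ` A. moebius_mu d)"
    unfolding split using finA by (intro sum.union_disjoint) (auto simp: A_def)
  also have "(\<Sum>d\<in>(*) p ` A. moebius_mu d) = (\<Sum>d\<in>A. - moebius_mu d)"
    unfolding sum.reindex[OF inj] using p(1)
    by (intro sum.cong) (auto simp: A_def moebius_mu_prime_mult)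
  finally show ?thesis using False by (simp add: sum_negf)
qed

text \<open>
  Both sides run over the pairs \<open>(d, k)\<close> with \<open>d * k \<le> N\<close>, on the right sorted by the
  product \<open>n = d * k\<close>.
\<close>

lemma sum_hyperbola:
  fixes h :: "nat \<Rightarrow> nat \<Rightarrow> real"
  shows "(\<Sum>d=1..N. \<Sum>k=1..N div d. h d k) = (\<Sum>n=1..N. \<Sum>d | d dvd n. h d (n div d))"
proof -
  have "(\<Sum>d=1..N. \<Sum>k=1..N div d. h d k) = (\<Sum>(d,k)\<in>Sigma {1..N} (\<lambda>d. {1..N div d}). h d k)"
    by (rule sum.Sigma) auto
  also have "\<dots> = (\<Sum>(n,d)\<in>Sigma {1..N} (\<lambda>n. {d. d dvd n}). h d (n div d))"
  proof -
    have prod: "0 < d * k \<and> d * k \<le> N" if "0 < d" "0 < k" "k \<le> N div d" for d k :: nat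
    proof -
      have "d * k \<le> d * (N div d)" using that by simp
      also have "\<dots> \<le> N" by simp
      finally show ?thesis using that by simp
    qed
    have quot: "0 < d \<and> d \<le> N \<and> 0 < n div d \<and> n div d \<le> N div d"
      if "0 < n" "n \<le> N" "d dvd n" for n d :: nat
    proof -
      have "0 < d" "d \<le> n" using that by (auto intro: Nat.gr0I dvd_imp_le)
      thus ?thesis using that by (auto simp: div_le_mono div_greater_zero_iff)
    qed
    show ?thesis
    proof (rule sum.reindex_bij_witness[where i = "\<lambda>(n,d). (d, n div d)" and j = "\<lambda>(d,k). (d * k, d)"])
      fix a assume a: "a \<in> Sigma {1..N} (\<lambda>d. {1..N div d})"
      obtain d k where [simp]: "a = (d, k)" by force
      have "0 < d" "0 < k" "k \<le> N div d" using a by auto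
      note * = this prod[OF this]
      show "(case case a of (d, k) \<Rightarrow> (d * k, d) of (n, d) \<Rightarrow> (d, n div d)) = a"
        using * by simp
      show "(case a of (d, k) \<Rightarrow> (d * k, d)) \<in> Sigma {1..N} (\<lambda>n. {d. d dvd n})"
        using * by (simp add: Suc_le_eq)
      show "(case case a of (d, k) \<Rightarrow> (d * k, d) of (n, d) \<Rightarrow> h d (n div d)) = (case a of (d, k) \<Rightarrow> h d k)"
        using * by simp
    next
      fix b assume b: "b \<in> Sigma {1..N} (\<lambda>n. {d. d dvd n})"
      obtain n d where [simp]: "b = (n, d)" by force
      have "0 < n" "n \<le> N" "d dvd n" using b by auto
      note * = this quot[OF this]
      show "(case case b of (n, d) \<Rightarrow> (d, n div d) of (d, k) \<Rightarrow> (d * k, d)) = b"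
        using * by simp
      show "(case b of (n, d) \<Rightarrow> (d, n div d)) \<in> Sigma {1..N} (\<lambda>d. {1..N div d})"
        using * by (simp add: Suc_le_eq)
    qed
  qed
  also have "\<dots> = (\<Sum>n=1..N. \<Sum>d | d dvd n. h d (n div d))"
    by (rule sum.Sigma[symmetric]) auto
  finally show ?thesis .
qed

text \<open>
  Applied to \<open>g n = f (N / n)\<close>, this recovers \<open>f N\<close> from the sums of \<open>f (N / (d * k))\<close> over \<open>k\<close>,
  which may be far easier to estimate than \<open>f\<close> itself.
\<close>

lemma moebius_mu_inversion:
  fixes g :: "nat \<Rightarrow> real"
  assumes "N \<ge> 1"
  shows "(\<Sum>d=1..N. moebius_mu d * (\<Sum>k=1..N div d. g (d * k))) = g 1"
proof -
  have "(\<Sum>d=1..N. moebius_mu d * (\<Sum>k=1..N div d. g (d * k))) =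
        (\<Sum>n=1..N. \<Sum>d | d dvd n. moebius_mu d * g (d * (n div d)))"
    by (simp only: sum_distrib_left sum_hyperbola[of "\<lambda>d k. moebius_mu d * g (d * k)"])
  also have "\<dots> = (\<Sum>n=1..N. (\<Sum>d | d dvd n. moebius_mu d) * g n)"
    by (simp add: sum_distrib_right)
  also have "\<dots> = (\<Sum>n=1..N. if n = 1 then g n else 0)"
    by (intro sum.cong refl) (auto simp: sum_moebius_mu_divisors)
  also have "\<dots> = g 1" using assms by (simp add: sum.delta)
  finally show ?thesis .
qed

definition totient_sum :: "nat \<Rightarrow> real" where
  "totient_sum n = (\<Sum>k=1..n. real (totient k))"

text \<open>
  Sorting by products turns the left-hand side into the sum over \<open>n \<le> N\<close> of
  the totients of all divisors of \<open>n\<close>, which is the sum of \<open>n\<close>.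
\<close>

lemma sum_totient_sum: "(\<Sum>k=1..N. totient_sum (N div k)) = real N * (real N + 1) / 2"
proof -
  have "(\<Sum>k=1..N. totient_sum (N div k)) = (\<Sum>n=1..N. \<Sum>d | d dvd n. real (totient (n div d)))"
    unfolding totient_sum_def by (rule sum_hyperbola)
  also have "\<dots> = (\<Sum>n=1..N. real n)"
  proof (intro sum.cong refl)
    fix n assume n: "n \<in> {1..N}"
    have "(\<Sum>d | d dvd n. real (totient (n div d))) = (\<Sum>d | d dvd n. real (totient d))"
      using n by (intro sum.reindex_bij_witness[of _ "\<lambda>d. n div d" "\<lambda>d. n div d"]) auto
    also have "\<dots> = real n" by (simp only: totient_divisor_sum flip: of_nat_sum)
    finally show "(\<Sum>d | d dvd n. real (totient (n div d))) = real n" .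
  qed
  also have "\<dots> = real N * (real N + 1) / 2"
    by (induction N) (auto simp: field_simps)
  finally show ?thesis .
qed

text \<open>
  The upper estimate of the tail is telescoping: \<open>1 / (k + 1)\<^sup>2 \<le> 1 / k - 1 / (k + 1)\<close>.
\<close>

lemma inverse_squares_tail:
  assumes "M \<ge> 1"
  shows "(\<Sum>k=1..M. 1 / (real k)\<^sup>2) \<le> pi\<^sup>2 / 6"
    and "pi\<^sup>2 / 6 \<le> (\<Sum>k=1..M. 1 / (real k)\<^sup>2) + 1 / real M"
proof -
  let ?S = "\<lambda>n. \<Sum>k=1..n. 1 / (real k)\<^sup>2"
  have "(\<lambda>n. \<Sum>k<n. 1 / (real k + 1)\<^sup>2) \<longlonglongrightarrow> pi\<^sup>2 / 6"
    using inverse_squares_sums by (simp add: sums_def add.commute)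
  moreover have "(\<Sum>k<n. 1 / (real k + 1)\<^sup>2) = ?S n" for n
    by (induction n) (auto simp: add.commute)
  ultimately have lim: "?S \<longlonglongrightarrow> pi\<^sup>2 / 6" by simp
  have "?S M \<le> ?S n" if "n \<ge> M" for n
    using that by (intro sum_mono2) auto
  thus "?S M \<le> pi\<^sup>2 / 6" using lim by (intro LIMSEQ_le_const) auto
  have "?S n \<le> ?S M + 1 / real M - 1 / real n" if "n \<ge> M" for n
    using that
  proof (induction n rule: dec_induct)
    case (step n)
    have "1 / (real (Suc n))\<^sup>2 \<le> 1 / real n - 1 / real (Suc n)"
      using step assms by (auto simp: divide_simps power2_eq_square)
    thus ?case using step by simp
  qed simp
  hence "?S n \<le> ?S M + 1 / real M" if "n \<ge> M" for n
    using that by (smt (verit) of_nat_0_le_iff zero_le_divide_1_iff)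
  thus "pi\<^sup>2 / 6 \<le> ?S M + 1 / real M" using lim by (intro LIMSEQ_le_const2) auto
qed

lemma harmonic_sum_le:
  assumes "N \<ge> 1"
  shows "(\<Sum>d=1..N. 1 / real d) \<le> 1 + ln (real N)"
  using assms
proof (induction N rule: dec_induct)
  case (step n)
  have "ln (real n) - ln (real (Suc n)) \<le> (real n - real (Suc n)) / real (Suc n)"
    using step by (intro ln_diff_le) auto
  thus ?case using step by simp
qed simp

text \<open>
  Mertens' estimate. The error \<open>E n = totient_sum n - 3 / pi\<^sup>2 * n\<^sup>2\<close> is hard to
  estimate directly, but its values at all the quotients \<open>N / k\<close> have a small sum: the totient
  sums add up to \<open>N * (N + 1) / 2\<close> and the quadratic terms to \<open>3 / pi\<^sup>2 *
  N\<^sup>2\<close> times a partial sum of \<open>pi\<^sup>2 / 6\<close>, so that the main terms cancel and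
  \<open>O(N)\<close> remains. Since \<open>moebius_mu\<close> is bounded by 1, inversion costs only a
  harmonic sum, hence a logarithm.
\<close>

lemma totient_sum_asymptotics:
  assumes "N \<ge> 1"
  shows "\<bar>totient_sum N - 3 / pi\<^sup>2 * (real N)\<^sup>2\<bar> \<le> 2 * real N * (1 + ln (real N))"
proof -
  define c where "c = 3 / pi\<^sup>2"
  have "9 < pi\<^sup>2" using power_strict_mono[of 3 pi 2] pi_gt3 by simp
  hence c: "0 < c" "c < 1/3" "c * (pi\<^sup>2 / 6) = 1/2" by (auto simp: c_def field_simps)
  \<comment> \<open>\<open>g n\<close> is the error at the real number \<open>N / n\<close>; the totient sum there is that of the integer part\<close>
  define g where "g = (\<lambda>n. totient_sum (N div n) - c * (real N / real n)\<^sup>2)"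
  have F: "\<bar>\<Sum>k=1..N div d. g (d * k)\<bar> \<le> 2 * (real N / real d)" if d: "d \<in> {1..N}" for d
  proof -
    \<comment> \<open>\<open>M\<close> is the integer part of \<open>r\<close>\<close>
    define M where "M = N div d"
    define r where "r = real N / real d"
    have M1: "M \<ge> 1" using d by (simp add: M_def div_greater_zero_iff Suc_le_eq)
    have Mr: "real M \<le> r" unfolding M_def r_def by (rule of_nat_div_le_of_nat)
    have "N < (M + 1) * d" using d
      by (metis M_def atLeastAtMost_iff dividend_less_div_times less_le_trans less_numeral_extra(1) mult_Suc semiring_norm(174) Suc_eq_plus1)
    hence "real N < (real M + 1) * real d" by (metis of_nat_1 of_nat_add of_nat_less_iff of_nat_mult)
    hence rM: "r < real M + 1" using d by (simp add: r_def divide_simps)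
    define S where "S = (\<Sum>k=1..M. 1 / (real k)\<^sup>2)"
    have "(\<Sum>k=1..M. g (d * k)) = (\<Sum>k=1..M. totient_sum (M div k)) - (\<Sum>k=1..M. c * r\<^sup>2 * (1 / (real k)\<^sup>2))"
      unfolding sum_subtractf[symmetric]
      by (intro sum.cong refl) (simp add: g_def M_def r_def div_mult2_eq power_divide power_mult_distrib)
    also have "\<dots> = real M * (real M + 1) / 2 - c * r\<^sup>2 * S"
      by (simp only: sum_totient_sum S_def sum_distrib_left)
    finally have eq: "(\<Sum>k=1..M. g (d * k)) = real M * (real M + 1) / 2 - c * r\<^sup>2 * S" .
    have "S \<le> pi\<^sup>2 / 6" "pi\<^sup>2 / 6 \<le> S + 1 / real M"
      using inverse_squares_tail[OF M1] by (auto simp: S_def)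
    hence "c * S \<le> 1/2" "1/2 \<le> c * S + c * (1 / real M)"
      using c by (metis mult_le_cancel_left_pos, metis distrib_left mult_le_cancel_left_pos)
    moreover have "c * (1 / real M) \<le> 1/3 * (1 / real M)" using c M1 by (intro mult_right_mono) auto
    ultimately have "c * S * r\<^sup>2 \<le> 1/2 * r\<^sup>2" "(1/2 - 1/3 * (1 / real M)) * r\<^sup>2 \<le> c * S * r\<^sup>2"
      by (intro mult_right_mono; simp)+
    moreover have "(1/2 - 1/3 * (1 / real M)) * r\<^sup>2 = r\<^sup>2 / 2 - r\<^sup>2 / (3 * real M)"
      by (simp add: algebra_simps)
    moreover have "c * S * r\<^sup>2 = c * r\<^sup>2 * S" by simp
    moreover have "r\<^sup>2 / (3 * real M) \<le> r"
    proof -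
      have "r * r \<le> r * (3 * real M)" using M1 Mr rM by (intro mult_left_mono) auto
      thus ?thesis using M1 by (simp add: divide_simps power2_eq_square)
    qed
    moreover have "(real M)\<^sup>2 \<le> r\<^sup>2" "r\<^sup>2 \<le> (real M + 1)\<^sup>2"
      using Mr rM by (intro power_mono; simp)+
    moreover have "(real M + 1)\<^sup>2 = (real M)\<^sup>2 + 2 * real M + 1"
      "real M * (real M + 1) / 2 = (real M)\<^sup>2 / 2 + real M / 2"
      by (simp_all add: power2_eq_square algebra_simps)
    moreover have "1 \<le> real M" using M1 by simp
    ultimately have "\<bar>real M * (real M + 1) / 2 - c * r\<^sup>2 * S\<bar> \<le> 2 * r"
      using Mr by linarith
    thus ?thesis using eq by (simp add: M_def r_def)
  qed
  have "totient_sum N - c * (real N)\<^sup>2 = (\<Sum>d=1..N. moebius_mu d * (\<Sum>k=1..N div d. g (d * k)))"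
    using moebius_mu_inversion[OF assms, of g] by (simp add: g_def)
  also have "\<bar>\<dots>\<bar> \<le> (\<Sum>d=1..N. 1 * (2 * (real N / real d)))"
    using F abs_moebius_mu_le
    by (intro order_trans[OF sum_abs] sum_mono) (simp only: abs_mult, intro mult_mono, auto)
  also have "\<dots> = 2 * real N * (\<Sum>d=1..N. 1 / real d)" by (simp add: sum_distrib_left)
  also have "\<dots> \<le> 2 * real N * (1 + ln (real N))"
    using harmonic_sum_le[OF assms] by (intro mult_left_mono) auto
  finally show ?thesis by (simp add: c_def)
qed

section \<open>The modular action and the open set\<close>

text \<open>
  \<open>Arg\<close> jumps along the negative axis, but twice the argument only enters through \<open>cis\<close>. Writing
  that factor with \<open>sgn\<close> makes the continuity of the action visible.
\<close>

lemma cis_uminus_double_Arg: "q \<noteq> 0 \<Longrightarrow> cis (- 2 * Arg q) = (cnj (sgn q))\<^sup>2"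
proof -
  assume q: "q \<noteq> 0"
  have "cis (- 2 * Arg q) = (cnj (cis (Arg q)))\<^sup>2"
    by (simp add: cis_cnj Complex.DeMoivre)
  thus ?thesis using q by (simp add: cis_Arg)
qed

lemma automorphy_factor_nonzero:
  fixes a b c d :: real
  assumes "Im z > 0" "a * d - b * c = 1"
  shows "of_real c * z + of_real d \<noteq> 0"
  using assms by (auto simp: complex_eq_iff)

lemma Im_moebius:
  fixes a b c d :: real
  assumes "Im z > 0" "a * d - b * c = 1"
  shows "Im (moebius (of_real a) (of_real b) (of_real c) (of_real d) z) =
           Im z / (norm (of_real c * z + of_real d))\<^sup>2"
proof -
  have "Im (moebius (of_real a) (of_real b) (of_real c) (of_real d) z)
        = (a * d - b * c) * Im z / (norm (of_real c * z + of_real d))\<^sup>2"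
    unfolding moebius_def by (simp add: Im_divide cmod_power2 algebra_simps)
  thus ?thesis using assms by simp
qed

lemma T1H_act_sgn:
  assumes "Im z > 0" "a * d - b * c = 1"
  shows "T1H_act a b c d (z, u) =
    (moebius (of_real a) (of_real b) (of_real c) (of_real d) z,
     u * (cnj (sgn (of_real c * z + of_real d)))\<^sup>2)"
  using cis_uminus_double_Arg[OF automorphy_factor_nonzero[OF assms]]
  by (simp add: T1H_act_def)

lemma continuous_on_T1H_act:
  assumes "a * d - b * c = 1"
  shows "continuous_on T1H (T1H_act a b c d)"
proof -
  have nz: "of_real c * fst p + of_real d \<noteq> 0" if "p \<in> T1H" for p :: "complex \<times> complex"
    using that automorphy_factor_nonzero[OF _ assms] by (auto simp: T1H_def)
  have "continuous_on T1H (\<lambda>p. ((of_real a * fst p + of_real b) / (of_real c * fst p + of_real d),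
      snd p * (cnj (sgn (of_real c * fst p + of_real d)))\<^sup>2) :: complex \<times> complex)"
    using nz by (intro continuous_intros) auto
  thus ?thesis
    by (rule continuous_on_eq) (use assms in \<open>auto simp: T1H_def T1H_act_sgn moebius_def\<close>)
qed

text \<open>
  In horocycle coordinates a vector \<open>(z, cis \<theta>)\<close> lies on a circle tangent to the real axis, as an
  outward normal; the Euclidean diameter of that circle is \<open>2 * Im z / (1 + cos \<theta>)\<close>. The conditions
  below say that this diameter exceeds 2 and that \<open>\<bar>\<theta>\<bar> < pi / 2\<close>. The box is a product set in these
  coordinates, so a long horocycle crosses it in pieces that all have the same length. Moreover
  \<open>Im z > 1\<close> on the box, which is what makes it interact with the modular group only
  through translations.
\<close>

definition cusp_box :: "(complex \<times> complex) set" where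
  "cusp_box = {(z, u) \<in> T1H. Re u > 0 \<and> Im z > 1 + Re u}"

definition cusp_set :: "(complex \<times> complex) set set" where
  "cusp_set = orbit ` cusp_box"

lemma orbit_in_cusp_set_iff:
  assumes "p \<in> T1H"
  shows "orbit p \<in> cusp_set \<longleftrightarrow>
    (\<exists>a b c d :: int. a * d - b * c = 1 \<and>
       T1H_act (of_int a) (of_int b) (of_int c) (of_int d) p \<in> cusp_box)"
proof -
  have "orbit p \<in> cusp_set \<longleftrightarrow> (\<exists>q\<in>cusp_box. orbit p = orbit q)"
    by (auto simp: cusp_set_def)
  also have "\<dots> \<longleftrightarrow> (\<exists>q\<in>cusp_box. q \<in> orbit p)"
    using assms by (intro bex_cong refl orbit_eq_iff) (auto simp: cusp_box_def)
  also have "\<dots> \<longleftrightarrow> (\<exists>a b c d :: int. a * d - b * c = 1 \<and>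
       T1H_act (of_int a) (of_int b) (of_int c) (of_int d) p \<in> cusp_box)"
    unfolding orbit_def by blast
  finally show ?thesis .
qed

lemma openin_cusp_box: "openin (top_of_set T1H) cusp_box"
proof -
  have "open {p :: complex \<times> complex. Re (snd p) > 0 \<and> Im (fst p) > 1 + Re (snd p)}"
    by (intro open_Collect_conj open_Collect_less continuous_intros)
  moreover have "cusp_box = T1H \<inter> {p. Re (snd p) > 0 \<and> Im (fst p) > 1 + Re (snd p)}"
    by (auto simp: cusp_box_def)
  ultimately show ?thesis by (metis openin_open)
qed

text \<open>
  The preimage of the set in the unit tangent bundle is the union of the preimages of the box under
  the individual elements of the group, all of them continuous.
\<close>

lemma openin_cusp_set: "openin M_top cusp_set"
  unfolding openin_M_top
proof
  show "cusp_set \<subseteq> M_space" by (auto simp: cusp_set_def M_space_def cusp_box_def)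
  let ?act = "\<lambda>(a, b, c, d). T1H_act (of_int a) (of_int b) (of_int c) (of_int d)"
  have "{p \<in> T1H. orbit p \<in> cusp_set} =
    (\<Union>(a, b, c, d)\<in>{(a, b, c, d). a * d - b * c = 1}. T1H \<inter> ?act (a, b, c, d) -` cusp_box)"
    using orbit_in_cusp_set_iff by fastforce
  moreover have "openin (top_of_set T1H) (T1H \<inter> ?act (a, b, c, d) -` cusp_box)"
    if "a * d - b * c = 1" for a b c d :: int
  proof -
    have det: "real_of_int a * real_of_int d - real_of_int b * real_of_int c = 1"
      using that by (metis of_int_1 of_int_diff of_int_mult)
    have maps: "?act (a, b, c, d) \<in> T1H \<rightarrow> T1H" using T1H_act_in_T1H[OF _ det] by auto
    have cont: "continuous_on T1H (?act (a, b, c, d))"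
      using continuous_on_T1H_act[OF det] by simp
    show ?thesis by (rule continuous_openin_preimage[OF cont maps openin_cusp_box])
  qed
  ultimately show "openin (top_of_set T1H) {p \<in> T1H. orbit p \<in> cusp_set}"
    by (auto intro!: openin_Union)
qed

section \<open>Crossings of a closed horocycle\<close>

text \<open>
  A matrix with lower row \<open>(c, d)\<close> maps the horocycle of height \<open>y\<close> to the circle of diameter
  \<open>1 / (c\<^sup>2 * y)\<close>, and \<open>x\<close> to a vector whose half angle has tangent \<open>(c * x + d) / (c * y)\<close> up to
  sign. The upper row only translates the image, and the box is invariant under translations.
\<close>

lemma horocycle_in_cusp_set_iff:
  assumes "y > 0"
  shows "orbit (Complex x y, cis pi) \<in> cusp_set \<longleftrightarrow>
    (\<exists>c d :: int. coprime c d \<and> \<bar>of_int c * x + of_int d\<bar> < \<bar>of_int c\<bar> * y \<and> 2 * (of_int c)\<^sup>2 * y < 1)"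
proof -
  have p: "(Complex x y, cis pi) \<in> T1H" using assms by (simp add: T1H_def)
  have *: "T1H_act (of_int a) (of_int b) (of_int c) (of_int d) (Complex x y, cis pi) \<in> cusp_box \<longleftrightarrow>
      \<bar>of_int c * x + of_int d\<bar> < \<bar>of_int c\<bar> * y \<and> 2 * (of_int c)\<^sup>2 * y < 1"
    if "a * d - b * c = 1" for a b c d :: int
  proof -
    have det: "real_of_int a * real_of_int d - real_of_int b * real_of_int c = 1"
      using that by (metis of_int_1 of_int_diff of_int_mult)
    define q where "q = complex_of_int c * Complex x y + of_int d"
    define s where "s = of_int c * x + of_int d"
    define t where "t = of_int c * y"
    have q: "Re q = s" "Im q = t" by (auto simp: q_def s_def t_def)
    have "q \<noteq> 0"
      using automorphy_factor_nonzero[of "Complex x y", OF _ det] assms by (simp add: q_def)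
    hence n: "(norm q)\<^sup>2 > 0" by simp
    have n2: "(norm q)\<^sup>2 = s\<^sup>2 + t\<^sup>2" by (simp add: cmod_power2 q)
    have "Re (cis pi * (cnj (sgn q))\<^sup>2) = (t\<^sup>2 - s\<^sup>2) / (norm q)\<^sup>2"
      by (simp add: power2_eq_square Re_sgn Im_sgn q diff_divide_distrib)
    hence "T1H_act (of_int a) (of_int b) (of_int c) (of_int d) (Complex x y, cis pi) \<in> cusp_box \<longleftrightarrow>
       (t\<^sup>2 - s\<^sup>2) / (norm q)\<^sup>2 > 0 \<and> y / (norm q)\<^sup>2 > 1 + (t\<^sup>2 - s\<^sup>2) / (norm q)\<^sup>2"
      using T1H_act_in_T1H[OF p det] Im_moebius[of "Complex x y", OF _ det] assms
      by (simp add: cusp_box_def T1H_act_sgn[OF _ det] flip: q_def)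
    also have "\<dots> \<longleftrightarrow> s\<^sup>2 < t\<^sup>2 \<and> 2 * t\<^sup>2 < y"
    proof -
      have "(t\<^sup>2 - s\<^sup>2) / (norm q)\<^sup>2 > 0 \<longleftrightarrow> s\<^sup>2 < t\<^sup>2"
        using n by (simp add: zero_less_divide_iff)
      moreover have "1 + (t\<^sup>2 - s\<^sup>2) / (norm q)\<^sup>2 = 2 * t\<^sup>2 / (norm q)\<^sup>2"
      proof -
        have "1 + (t\<^sup>2 - s\<^sup>2) / (norm q)\<^sup>2 = ((norm q)\<^sup>2 + (t\<^sup>2 - s\<^sup>2)) / (norm q)\<^sup>2"
          using n by (simp add: add_divide_distrib)
        also have "(norm q)\<^sup>2 + (t\<^sup>2 - s\<^sup>2) = 2 * t\<^sup>2" by (simp add: n2)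
        finally show ?thesis .
      qed
      ultimately show ?thesis using n by (simp add: divide_less_cancel)
    qed
    also have "s\<^sup>2 < t\<^sup>2 \<longleftrightarrow> \<bar>s\<bar> < \<bar>of_int c\<bar> * y"
    proof -
      have "\<bar>t\<bar> = \<bar>of_int c\<bar> * y" using assms by (simp add: t_def abs_mult)
      thus ?thesis using abs_le_square_iff[of t s] by linarith
    qed
    also have "2 * t\<^sup>2 < y \<longleftrightarrow> 2 * (of_int c)\<^sup>2 * y < 1"
    proof -
      have "2 * t\<^sup>2 < y \<longleftrightarrow> (2 * (of_int c)\<^sup>2 * y) * y < 1 * y"
        by (simp add: t_def power2_eq_square mult_ac)
      thus ?thesis using assms by (simp only: mult_less_cancel_right_pos)
    qed
    finally show ?thesis by (simp add: s_def)
  qed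
  have "(\<exists>a b. a * d - b * c = 1) \<longleftrightarrow> coprime c d" for c d :: int
  proof
    assume "\<exists>a b. a * d - b * c = 1"
    then obtain a b where "a * d - b * c = 1" by blast
    thus "coprime c d" by (intro coprimeI) (metis dvd_diff dvd_mult)
  next
    assume "coprime c d"
    then obtain u v where "u * c + v * d = 1" using bezout_int[of c d] by auto
    hence "v * d - (- u) * c = 1" by simp
    thus "\<exists>a b. a * d - b * c = 1" by blast
  qed
  thus ?thesis unfolding orbit_in_cusp_set_iff[OF p] using * by (metis (no_types, lifting))
qed

text \<open>
  The times at which the horocycle is within \<open>y\<close> of a fraction with denominator \<open>c\<close> and
  numerator \<open>a\<close> modulo \<open>c\<close>. The fractions \<open>0\<close> and \<open>1\<close>, both represented by \<open>a = c = 1\<close>, each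
  contribute the half of an interval that lies inside the period \<open>{0..1}\<close>.
\<close>

definition farey_interval :: "real \<Rightarrow> nat \<times> nat \<Rightarrow> real set" where
  "farey_interval y = (\<lambda>(c, a). if c = 1 then {0..<y} \<union> {1 - y<..1}
     else {real a / real c - y<..<real a / real c + y})"

text \<open>
  Distinct reduced fractions with denominators \<open>c\<close> and \<open>c'\<close> differ by at least \<open>1 / (c * c')\<close>,
  while the bounds on the denominators give \<open>2 * y < 1 / (c * c')\<close>.
\<close>

lemma farey_neighbours_apart:
  fixes c c' :: nat and a a' :: int
  assumes "\<bar>x - of_int a / real c\<bar> < y" "\<bar>x - of_int a' / real c'\<bar> < y"
    and "2 * (real c)\<^sup>2 * y < 1" "2 * (real c')\<^sup>2 * y < 1" "c > 0" "c' > 0"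
    and "coprime (int c) a" "coprime (int c') a'"
  shows "c = c' \<and> a = a'"
proof -
  have y: "y > 0" using assms(1) by linarith
  have "(2 * y * real c * real c')\<^sup>2 = (2 * (real c)\<^sup>2 * y) * (2 * (real c')\<^sup>2 * y)"
    by (simp add: power2_eq_square)
  also have "\<dots> < 1 * 1" using assms y by (intro mult_strict_mono) auto
  finally have "2 * y * real c * real c' < 1" using power2_less_imp_less[of _ 1] by simp
  moreover have "\<bar>of_int a / real c - of_int a' / real c'\<bar> < 2 * y" using assms(1,2) by linarith
  hence "\<bar>of_int a / real c - of_int a' / real c'\<bar> * (real c * real c') < 2 * y * (real c * real c')"
    using assms by (intro mult_strict_right_mono) auto
  moreover have "\<bar>of_int a / real c - of_int a' / real c'\<bar> * (real c * real c') =
      \<bar>of_int (a * int c' - a' * int c)\<bar>"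
  proof -
    have "\<bar>of_int a / real c - of_int a' / real c'\<bar> * \<bar>real c * real c'\<bar> =
       \<bar>of_int (a * int c' - a' * int c)\<bar>"
      unfolding abs_mult[symmetric] using assms by (intro arg_cong[of _ _ abs]) (simp add: field_simps)
    thus ?thesis by simp
  qed
  ultimately have "\<bar>real_of_int (a * int c' - a' * int c)\<bar> < 1" by simp
  hence eq: "a * int c' = a' * int c" by linarith
  have "int c dvd a * int c'" "int c' dvd a' * int c" using eq by (metis dvd_triv_right)+
  hence "int c dvd int c'" "int c' dvd int c"
    using assms by (metis coprime_dvd_mult_right_iff)+
  hence "c = c'" by (simp add: dvd_antisym)
  thus ?thesis using eq assms by simp
qed

text \<open>
  The numerator \<open>b\<close> differs from \<open>a\<close> only in case \<open>c = 1\<close>, where it may be \<open>0\<close> as well as \<open>1\<close>.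
\<close>

lemma farey_interval_fraction:
  assumes "x \<in> farey_interval y (c, a)" "a \<in> totatives c"
  obtains b :: int where "\<bar>x - of_int b / real c\<bar> < y" "coprime (int c) b" "c \<noteq> 1 \<Longrightarrow> b = int a"
proof (cases "c = 1")
  case True
  hence "x \<in> {0..<y} \<or> x \<in> {1 - y<..1}" using assms by (auto simp: farey_interval_def)
  thus ?thesis
  proof
    assume "x \<in> {0..<y}" thus ?thesis using that[of 0] True by auto
  next
    assume "x \<in> {1 - y<..1}" thus ?thesis using that[of 1] True by auto
  qed
next
  case False
  have "coprime (int c) (int a)" using assms by (simp add: in_totatives_iff coprime_commute)
  thus ?thesis using that[of "int a"] assms False
    by (auto simp: farey_interval_def abs_less_iff)
qed

lemma disjoint_farey_intervals:
  assumes "\<And>c. c \<in> {1..N} \<Longrightarrow> 2 * (real c)\<^sup>2 * y < 1"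
  shows "disjoint_family_on (farey_interval y) (Sigma {1..N} totatives)"
  unfolding disjoint_family_on_def
proof (intro ballI impI)
  fix m n assume mn: "m \<in> Sigma {1..N} totatives" "n \<in> Sigma {1..N} totatives" "m \<noteq> n"
  obtain c a c' a' where eq: "m = (c, a)" "n = (c', a')" by fastforce
  show "farey_interval y m \<inter> farey_interval y n = {}"
  proof (rule ccontr)
    assume "farey_interval y m \<inter> farey_interval y n \<noteq> {}"
    then obtain x where x: "x \<in> farey_interval y (c, a)" "x \<in> farey_interval y (c', a')"
      by (auto simp: eq)
    have ta: "a \<in> totatives c" "a' \<in> totatives c'" using mn by (auto simp: eq)
    obtain b where b: "\<bar>x - of_int b / real c\<bar> < y" "coprime (int c) b" "c \<noteq> 1 \<Longrightarrow> b = int a"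
      using farey_interval_fraction[OF x(1) ta(1)] by blast
    obtain b' where b': "\<bar>x - of_int b' / real c'\<bar> < y" "coprime (int c') b'" "c' \<noteq> 1 \<Longrightarrow> b' = int a'"
      using farey_interval_fraction[OF x(2) ta(2)] by blast
    have "c = c' \<and> b = b'"
      using mn by (intro farey_neighbours_apart[OF b(1) b'(1)] b b' assms) (auto simp: eq)
    hence "m = n" using b(3) b'(3) ta by (cases "c = 1") (auto simp: eq)
    thus False using mn(3) by simp
  qed
qed

lemma measure_farey_interval:
  assumes "0 < y" "y < 1/2"
  shows "farey_interval y i \<in> sets borel" "emeasure lborel (farey_interval y i) = ennreal (2 * y)"
proof -
  obtain c a where i: "i = (c, a)" by force
  show "farey_interval y i \<in> sets borel" by (auto simp: farey_interval_def i)
  show "emeasure lborel (farey_interval y i) = ennreal (2 * y)"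
  proof (cases "c = 1")
    case True
    have "emeasure lborel ({0..<y} \<union> {1 - y<..1}) = emeasure lborel {0..<y} + emeasure lborel {1 - y<..1}"
      using assms by (intro plus_emeasure[symmetric]) auto
    thus ?thesis using True assms by (simp add: i farey_interval_def flip: ennreal_plus)
  qed (use assms in \<open>simp add: i farey_interval_def\<close>)
qed

text \<open>
  A fraction with denominator \<open>c\<close> outside \<open>{0..1}\<close> is at distance at least \<open>1 / c\<close> from it, which
  exceeds \<open>y\<close> since \<open>y < 1 / (2 * c\<^sup>2)\<close>. So only fractions in \<open>{0..1}\<close> itself matter.
  The number \<open>N\<close> stands for the largest denominator admitted by the diameter condition.
\<close>

lemma horocycle_times_eq_farey_intervals:
  assumes y: "y > 0" and N: "\<And>c. c \<ge> 1 \<Longrightarrow> 2 * (real c)\<^sup>2 * y < 1 \<longleftrightarrow> c \<le> N"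
  shows "{x \<in> {0..1}. orbit (Complex x y, cis pi) \<in> cusp_set} =
    (\<Union>i\<in>Sigma {1..N} totatives. farey_interval y i)"
proof (intro equalityI subsetI)
  fix x assume "x \<in> {x \<in> {0..1}. orbit (Complex x y, cis pi) \<in> cusp_set}"
  hence x: "0 \<le> x" "x \<le> 1" and "orbit (Complex x y, cis pi) \<in> cusp_set" by auto
  then obtain c d :: int where cd: "coprime c d" "\<bar>of_int c * x + of_int d\<bar> < \<bar>of_int c\<bar> * y"
    "2 * (of_int c)\<^sup>2 * y < 1"
    using horocycle_in_cusp_set_iff[OF y] by blast
  have c0: "c \<noteq> 0" using cd(2) by auto
  \<comment> \<open>the fraction \<open>- d / c\<close>, normalised to a positive denominator\<close>
  define C where "C = nat \<bar>c\<bar>"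
  define A where "A = - d * sgn c"
  have C: "C \<ge> 1" "real C = \<bar>of_int c\<bar>" using c0 by (auto simp: C_def)
  have cop: "coprime (int C) A"
    using cd(1) c0 by (cases "c > 0") (auto simp: C_def A_def sgn_if)
  have CN: "2 * (real C)\<^sup>2 * y < 1" using cd(3) C by simp
  hence "C \<le> N" using N C by blast
  have "\<bar>real C * x - of_int A\<bar> = \<bar>of_int c * x + of_int d\<bar>"
    by (cases "c > 0") (use c0 in \<open>auto simp: C(2) A_def sgn_if\<close>)
  hence *: "\<bar>real C * x - of_int A\<bar> < real C * y" using cd(2) C by simp
  have "real C * (real C * y) < 1 / 2" using CN by (simp add: power2_eq_square)
  moreover have "1 * (real C * y) \<le> real C * (real C * y)" using C(1) y by (intro mult_right_mono) auto
  ultimately have Cy: "real C * y < 1/2" by linarith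
  have Cx: "0 \<le> real C * x" "real C * x \<le> real C" using x by (auto simp: mult_left_le)
  have "- 1/2 < real_of_int A" "real_of_int A < real C + 1/2" using * Cy Cx by linarith+
  hence A: "0 \<le> A" "A \<le> int C" by linarith+
  show "x \<in> (\<Union>i\<in>Sigma {1..N} totatives. farey_interval y i)"
  proof (cases "C = 1")
    case True
    hence "A = 0 \<or> A = 1" using A by auto
    hence "x \<in> farey_interval y (1, 1)"
      using * True x by (auto simp: farey_interval_def)
    moreover have "(1, 1) \<in> Sigma {1..N} totatives" using True \<open>C \<le> N\<close> by simp
    ultimately show ?thesis by blast
  next
    case False
    have "A \<noteq> 0" using cop False C(1) by auto
    hence "nat A \<in> totatives C" using A cop
      by (auto simp: in_totatives_iff coprime_commute nat_le_iff simp flip: coprime_int_iff)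
    hence "(C, nat A) \<in> Sigma {1..N} totatives" using C \<open>C \<le> N\<close> by simp
    moreover have "x \<in> farey_interval y (C, nat A)"
    proof -
      have "\<bar>real C * (x - of_int A / real C)\<bar> < real C * y" using * C(1) by (simp add: algebra_simps)
      hence "\<bar>x - of_int A / real C\<bar> < y" using C(1) by (simp add: abs_mult)
      thus ?thesis using False A by (auto simp: farey_interval_def abs_less_iff)
    qed
    ultimately show ?thesis by blast
  qed
next
  fix x assume "x \<in> (\<Union>i\<in>Sigma {1..N} totatives. farey_interval y i)"
  then obtain c a where ca: "c \<in> {1..N}" "a \<in> totatives c" and x: "x \<in> farey_interval y (c, a)"
    by auto
  obtain b where b: "\<bar>x - of_int b / real c\<bar> < y" "coprime (int c) b" "c \<noteq> 1 \<Longrightarrow> b = int a"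
    using farey_interval_fraction[OF x ca(2)] by blast
  have c1: "real c \<ge> 1" using ca by simp
  have cy: "2 * (real c)\<^sup>2 * y < 1" using N ca by simp
  have "real c * \<bar>x - of_int b / real c\<bar> < real c * y" using b(1) c1 by simp
  also have "real c * \<bar>x - of_int b / real c\<bar> = \<bar>real c * (x - of_int b / real c)\<bar>"
    by (simp add: abs_mult)
  also have "real c * (x - of_int b / real c) = of_int (int c) * x + of_int (- b)"
    using c1 by (simp add: algebra_simps)
  finally have "\<bar>of_int (int c) * x + of_int (- b)\<bar> < \<bar>of_int (int c)\<bar> * y" by simp
  moreover have "coprime (int c) (- b)" using b by simp
  moreover have "2 * (of_int (int c))\<^sup>2 * y < 1" using cy by simp
  ultimately have "orbit (Complex x y, cis pi) \<in> cusp_set"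
    using horocycle_in_cusp_set_iff[OF y] by blast
  moreover have "x \<in> {0..1}"
  proof (cases "c = 1")
    case True
    hence "y < 1" using cy by simp
    thus ?thesis using x True by (auto simp: farey_interval_def)
  next
    case False
    have "a < c" using ca False totatives_less[of a c] by auto
    moreover have "a > 0" using ca by (simp add: in_totatives_iff)
    ultimately have a: "1 \<le> real a" "real a \<le> real c - 1" by linarith+
    have "real c * (real c * y) < 1 / 2" using cy by (simp add: power2_eq_square)
    moreover have "1 * (real c * y) \<le> real c * (real c * y)" using c1 y by (intro mult_right_mono) auto
    ultimately have "real c * y < 1" by linarith
    moreover have "real c * (real a / real c - y) \<le> real c * x" "real c * x \<le> real c * (real a / real c + y)"
      using x False c1 by (auto simp: farey_interval_def)
    moreover have "real c * (real a / real c - y) = real a - real c * y"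
       "real c * (real a / real c + y) = real a + real c * y" using c1 by (simp_all add: algebra_simps)
    ultimately have "real c * 0 \<le> real c * x" "real c * x \<le> real c * 1" using a by linarith+
    moreover have "real c > 0" using c1 by simp
    ultimately have "0 \<le> x" "x \<le> 1" by (simp_all only: mult_le_cancel_left_pos)
    thus ?thesis by simp
  qed
  ultimately show "x \<in> {x \<in> {0..1}. orbit (Complex x y, cis pi) \<in> cusp_set}" by simp
qed

lemma cusp_set_measurable: "cusp_set \<in> sets M_borel"
  using openin_cusp_set by (auto simp: sets_M_borel)

lemma horocycle_measurable:
  assumes "y > 0"
  shows "(\<lambda>x. orbit (Complex x y, cis pi)) \<in> borel \<rightarrow>\<^sub>M M_borel"
proof -
  have "(\<lambda>x. (Complex x y, cis pi)) \<in> borel_measurable borel"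
    by (intro borel_measurable_continuous_onI continuous_intros)
  hence "(\<lambda>x. (Complex x y, cis pi)) \<in> borel \<rightarrow>\<^sub>M haar_T1H"
    unfolding measurable_cong_sets[OF refl sets_haar_T1H]
    using assms by (intro measurable_restrict_space2) (auto simp: T1H_def)
  thus ?thesis by (rule measurable_compose[OF _ measurable_orbit])
qed

text \<open>
  The horocycle crosses the open set once for each fraction counted by \<open>totient_sum N\<close>, and
  every crossing takes time \<open>2 * y\<close>.
\<close>

lemma horocycle_measure_cusp_set:
  assumes y: "y > 0" and N: "\<And>c. c \<ge> 1 \<Longrightarrow> 2 * (real c)\<^sup>2 * y < 1 \<longleftrightarrow> c \<le> N"
  shows "measure (horocycle_measure y) cusp_set = 2 * y * totient_sum N"
proof -
  let ?f = "\<lambda>x. orbit (Complex x y, cis pi)"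
  let ?I = "Sigma {1..N} totatives"
  have f: "?f \<in> uniform_measure lborel {0..1::real} \<rightarrow>\<^sub>M M_borel"
    using horocycle_measurable[OF y] by (simp cong: measurable_cong_sets)
  have meas: "?f -` cusp_set \<in> sets lborel"
    using measurable_sets[OF f cusp_set_measurable] by simp
  have "measure (horocycle_measure y) cusp_set = measure (uniform_measure lborel {0..1::real}) (?f -` cusp_set)"
    unfolding horocycle_measure_def using measure_distr[OF f cusp_set_measurable] by simp
  also have "\<dots> = measure lborel ({0..1} \<inter> ?f -` cusp_set)"
    using meas by (subst measure_uniform_measure) auto
  also have "{0..1} \<inter> ?f -` cusp_set = {x \<in> {0..1}. ?f x \<in> cusp_set}" by auto
  also have "\<dots> = (\<Union>i\<in>?I. farey_interval y i)"
    by (rule horocycle_times_eq_farey_intervals[OF assms])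
  also have "measure lborel \<dots> = (\<Sum>i\<in>?I. measure lborel (farey_interval y i))"
  proof (cases "N = 0")
    case False
    hence y2: "y < 1/2" using N[of 1] by simp
    show ?thesis
      using measure_farey_interval[OF y y2]  
      by (intro measure_finite_Union disjoint_farey_intervals) (use N in auto)
  qed simp
  also have "\<dots> = (\<Sum>i\<in>?I. 2 * y)"
  proof (intro sum.cong refl)
    fix i assume "i \<in> ?I"
    hence "1 \<le> N" by auto
    hence y2: "y < 1/2" using N[of 1] by simp
    show "measure lborel (farey_interval y i) = 2 * y"
      using measure_farey_interval(2)[OF y y2, of i] y by (simp add: measure_def)
  qed
  also have "\<dots> = 2 * y * totient_sum N"
    by (simp add: totient_sum_def totient_def)
  finally show ?thesis .
qed

section \<open>The Haar measure of the open set\<close>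

text \<open>
  If a matrix with lower row \<open>(c, d)\<close> moves \<open>(z, u)\<close> to height above 1, then
  \<open>\<bar>c * z + d\<bar>\<^sup>2 < Im z\<close>. In the fundamental domain the left-hand side is at least 1, so \<open>Im z > 1\<close>; and
  it is at least \<open>(c * Im z)\<^sup>2\<close>, which then forces \<open>c = 0\<close>. What remains are translations, and they
  preserve the box.
\<close>

lemma orbit_in_cusp_set_fund_dom_iff:
  assumes "p \<in> fund_dom"
  shows "orbit p \<in> cusp_set \<longleftrightarrow> p \<in> cusp_box"
proof
  obtain z u where pz: "p = (z, u)" by force
  have p: "p \<in> T1H" and z: "Im z > 0" "\<bar>Re z\<bar> \<le> 1/2" "1 \<le> norm z"
    using assms by (auto simp: fund_dom_def T1H_def pz)
  show "p \<in> cusp_box" if orb: "orbit p \<in> cusp_set"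
  proof -
    obtain a b c d :: int where det: "a * d - b * c = 1"
      and box: "T1H_act (of_int a) (of_int b) (of_int c) (of_int d) p \<in> cusp_box"
      using orb orbit_in_cusp_set_iff[OF p] by blast
    have rdet: "real_of_int a * real_of_int d - real_of_int b * real_of_int c = 1"
      using det by (metis of_int_1 of_int_diff of_int_mult)
    define q where "q = complex_of_real (of_int c) * z + of_real (of_int d)"
    have q0: "q \<noteq> 0" unfolding q_def by (rule automorphy_factor_nonzero[OF z(1) rdet])
    have act: "T1H_act (of_int a) (of_int b) (of_int c) (of_int d) p =
        (moebius (of_int a) (of_int b) (of_int c) (of_int d) z, u * (cnj (sgn q))\<^sup>2)"
      using T1H_act_sgn[OF z(1) rdet] by (simp add: pz q_def)
    have Im: "Im (moebius (of_int a) (of_int b) (of_int c) (of_int d) z) = Im z / (norm q)\<^sup>2"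
      using Im_moebius[OF z(1) rdet] by (simp add: q_def)
    have "Im z / (norm q)\<^sup>2 > 1"
      using box unfolding act cusp_box_def Im[symmetric] by auto
    hence less: "(norm q)\<^sup>2 < Im z" using q0 by (simp add: less_divide_eq)
    have c0: "c = 0"
    proof (rule ccontr)
      assume "c \<noteq> 0"
      hence "1 \<le> \<bar>c\<bar>" by simp
      hence c1: "1 \<le> \<bar>real_of_int c\<bar>" by linarith
      have "Im z \<le> \<bar>real_of_int c\<bar> * Im z" using c1 z(1) by simp
      also have "\<dots> = \<bar>Im q\<bar>" using z(1) by (simp add: q_def abs_mult)
      also have "\<dots> \<le> norm q" by (rule abs_Im_le_cmod)
      finally have yq: "Im z \<le> norm q" .
      have "1 \<le> (norm q)\<^sup>2"
      proof -
        have "(norm q)\<^sup>2 = (of_int c)\<^sup>2 * (norm z)\<^sup>2 + 2 * of_int c * of_int d * Re z + (of_int d)\<^sup>2"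
          unfolding q_def cmod_power2 by (simp add: power2_eq_square algebra_simps)
        moreover have "(of_int c)\<^sup>2 * 1 \<le> (of_int c)\<^sup>2 * (norm z)\<^sup>2"
          using z(3) by (intro mult_left_mono) (auto simp: power2_nonneg_ge_1_iff)
        moreover have "\<bar>2 * of_int c * of_int d * Re z\<bar> \<le> \<bar>of_int c * of_int d\<bar>"
          using mult_left_mono[OF z(2), of "2 * \<bar>of_int c * of_int d\<bar>"] by (simp add: abs_mult)
        moreover have "real_of_int (c\<^sup>2 + d\<^sup>2 - \<bar>c * d\<bar>) \<ge> 1"
        proof -
          have "(\<bar>c\<bar> - \<bar>d\<bar>)\<^sup>2 + \<bar>c * d\<bar> = c\<^sup>2 + d\<^sup>2 - \<bar>c * d\<bar>"
            by (simp add: power2_eq_square algebra_simps abs_mult abs_mult_self_eq)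
          moreover have "(\<bar>c\<bar> - \<bar>d\<bar>)\<^sup>2 + \<bar>c * d\<bar> > 0"
          proof (cases "d = 0")
            case False
            hence "\<bar>c * d\<bar> > 0" using \<open>c \<noteq> 0\<close> by simp
            thus ?thesis by (intro add_nonneg_pos) auto
          qed (use \<open>c \<noteq> 0\<close> in simp)
          ultimately show ?thesis by linarith
        qed
        ultimately show ?thesis by (simp add: abs_le_iff)
      qed
      hence "1 < Im z" using less by linarith
      hence "Im z * 1 < Im z * Im z" by (intro mult_strict_left_mono) auto
      also have "\<dots> \<le> norm q * norm q" using yq z(1) by (intro mult_mono) auto
      finally show False using less by (simp add: power2_eq_square)
    qed
    hence "d dvd 1" using det by (metis diff_zero dvd_triv_right mult_zero_right)
    hence "q = 1 \<or> q = -1" by (auto simp: q_def c0 zdvd1_eq abs_if split: if_splits)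
    hence "(cnj (sgn q))\<^sup>2 = 1" "norm q = 1" by (auto simp: sgn_if sgn_minus)
    thus ?thesis using box p unfolding act cusp_box_def by (simp add: Im pz)
  qed
  have "T1H_act (of_int 1) (of_int 0) (of_int 0) (of_int 1) p = p"
    by (simp add: T1H_act_def moebius_def pz)
  thus "orbit p \<in> cusp_set" if "p \<in> cusp_box"
    using that unfolding orbit_in_cusp_set_iff[OF p]
    by (intro exI[of _ 1] exI[of _ 0]) auto
qed

lemma measurable_Complex: "(\<lambda>(x, y). Complex x y) \<in> lborel \<Otimes>\<^sub>M lborel \<rightarrow>\<^sub>M borel"
proof -
  have "(\<lambda>p. Complex (fst p) (snd p)) \<in> borel_measurable borel"
    by (intro borel_measurable_continuous_onI continuous_intros)
  thus ?thesis by (simp add: borel_prod lborel_prod case_prod_beta)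
qed

lemma lborel_complex_eq_distr:
  "(lborel :: complex measure) = distr (lborel \<Otimes>\<^sub>M lborel) borel (\<lambda>(x, y). Complex x y)"
proof (rule lborel_eqI)
  fix l u :: complex
  assume le: "\<And>b. b \<in> Basis \<Longrightarrow> l \<bullet> b \<le> u \<bullet> b"
  have *: "Re l \<le> Re u" "Im l \<le> Im u" using le[of 1] le[of \<i>] by (auto simp: Basis_complex_def)
  have "(\<lambda>(x, y). Complex x y) -` box l u \<inter> space (lborel \<Otimes>\<^sub>M lborel) = {Re l<..<Re u} \<times> {Im l<..<Im u}"
    by (auto simp: in_box_complex_iff space_pair_measure)
  hence "emeasure (distr (lborel \<Otimes>\<^sub>M lborel) borel (\<lambda>(x, y). Complex x y)) (box l u) =
      emeasure (lborel \<Otimes>\<^sub>M lborel) ({Re l<..<Re u} \<times> {Im l<..<Im u})"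
    using measurable_Complex by (simp add: emeasure_distr)
  also have "\<dots> = ennreal ((Re u - Re l) * (Im u - Im l))"
    using * by (subst lborel.emeasure_pair_measure_Times) (auto simp: ennreal_mult)
  finally show "emeasure (distr (lborel \<Otimes>\<^sub>M lborel) borel (\<lambda>(x, y). Complex x y)) (box l u) =
      ennreal (\<Prod>b\<in>Basis. (u - l) \<bullet> b)"
    by (simp add: Basis_complex_def)
qed simp

lemma nn_integral_inverse_square_above:
  assumes "c > (0::real)"
  shows "(\<integral>\<^sup>+y. ennreal (1 / y\<^sup>2) * indicator {c..} y \<partial>lborel) = ennreal (1 / c)"
proof -
  have "(\<integral>\<^sup>+y. ennreal (1 / y\<^sup>2) * indicator {c..} y \<partial>lborel) = ennreal (0 - (- (1 / c)))"
  proof (rule nn_integral_FTC_atLeast)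
    show "((\<lambda>y. - (1 / y)) has_real_derivative 1 / y\<^sup>2) (at y)" if "c \<le> y" for y :: real
      using that assms by (auto intro!: derivative_eq_intros simp: power2_eq_square)
    have "((\<lambda>y::real. - inverse y) \<longlongrightarrow> - 0) at_top"
      by (intro tendsto_minus tendsto_inverse_0_at_top filterlim_ident)
    thus "((\<lambda>y::real. - (1 / y)) \<longlongrightarrow> 0) at_top" by (simp add: divide_inverse)
  qed auto
  thus ?thesis by simp
qed

text \<open>
  Membership of the points on the graph of \<open>h\<close> is left open, so that the lemma covers both
  the closed fundamental domain and the open box.
\<close>

lemma hyperbolic_area_above_graph:
  fixes A :: "complex set" and h :: "real \<Rightarrow> real"
  assumes A: "A \<in> sets borel" and h: "\<And>x. \<bar>x\<bar> \<le> 1/2 \<Longrightarrow> h x > 0"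
    and in_A: "\<And>x y. \<bar>x\<bar> \<le> 1/2 \<Longrightarrow> y \<noteq> h x \<Longrightarrow> Complex x y \<in> A \<longleftrightarrow> h x < y"
    and strip: "\<And>z. z \<in> A \<Longrightarrow> \<bar>Re z\<bar> \<le> 1/2"
  shows "(\<integral>\<^sup>+z\<in>A. ennreal (1 / (Im z)\<^sup>2) \<partial>lborel) =
    (\<integral>\<^sup>+x. ennreal (1 / h x) * indicator {-1/2..1/2} x \<partial>lborel)"
proof -
  let ?g = "\<lambda>z. ennreal (1 / (Im z)\<^sup>2) * indicator A z"
  have "Im \<in> borel_measurable borel"
    by (intro borel_measurable_continuous_onI continuous_intros)
  hence g: "?g \<in> borel_measurable borel" using A by measurable
  have "(\<integral>\<^sup>+z. ?g z \<partial>lborel) = (\<integral>\<^sup>+p. ?g (case p of (x, y) \<Rightarrow> Complex x y) \<partial>(lborel \<Otimes>\<^sub>M lborel))"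
    by (subst lborel_complex_eq_distr, rule nn_integral_distr[OF measurable_Complex]) (simp add: g)
  also have "\<dots> = (\<integral>\<^sup>+x. \<integral>\<^sup>+y. ?g (Complex x y) \<partial>lborel \<partial>lborel)"
    using lborel.nn_integral_fst[OF measurable_compose[OF measurable_Complex g]] by simp
  also have "\<dots> = (\<integral>\<^sup>+x. ennreal (1 / h x) * indicator {-1/2..1/2} x \<partial>lborel)"
  proof (intro nn_integral_cong)
    fix x :: real
    show "(\<integral>\<^sup>+y. ?g (Complex x y) \<partial>lborel) = ennreal (1 / h x) * indicator {-1/2..1/2} x"
    proof (cases "\<bar>x\<bar> \<le> 1/2")
      case True
      have "(\<integral>\<^sup>+y. ?g (Complex x y) \<partial>lborel) = (\<integral>\<^sup>+y. ennreal (1 / y\<^sup>2) * indicator {h x..} y \<partial>lborel)"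
        using AE_lborel_singleton[of "h x"]
        by (intro nn_integral_cong_AE) (use in_A[OF True] in \<open>auto elim!: eventually_mono simp: indicator_def\<close>)
      also have "\<dots> = ennreal (1 / h x)" by (rule nn_integral_inverse_square_above[OF h[OF True]])
      finally show ?thesis using True by (auto simp: indicator_def)
    next
      case False
      hence "Complex x y \<notin> A" for y using strip[of "Complex x y"] by auto
      thus ?thesis using False by (auto simp: indicator_def)
    qed
  qed
  finally show ?thesis .
qed

text \<open>
  The area of the modular domain is \<open>pi / 3\<close>, since the arc of the unit circle bounding it from
  below contributes the integral of the derivative of \<open>arcsin\<close>; the angles give the factor \<open>2 * pi\<close>.
\<close>

lemma emeasure_haar_fund_dom: "emeasure haar_T1H fund_dom = ennreal (2 * pi\<^sup>2 / 3)"
proof -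
  let ?A = "{z. Im z > 0} \<inter> {z. \<bar>Re z\<bar> \<le> 1/2 \<and> norm z \<ge> 1}"
  have "open {z. Im z > 0}" by (intro open_Collect_less continuous_intros)
  moreover have "closed {z::complex. \<bar>Re z\<bar> \<le> 1/2 \<and> norm z \<ge> 1}"
    by (intro closed_Collect_conj closed_Collect_le continuous_intros)
  ultimately have A: "?A \<in> sets borel" by (intro sets.Int borel_open borel_closed)
  have small: "x\<^sup>2 < 1" if "\<bar>x\<bar> \<le> 1/2" for x :: real
    using that by (simp add: abs_square_less_1)
  have "(\<integral>\<^sup>+z\<in>?A. ennreal (1 / (Im z)\<^sup>2) \<partial>lborel) =
      (\<integral>\<^sup>+x. ennreal (1 / sqrt (1 - x\<^sup>2)) * indicator {-1/2..1/2} x \<partial>lborel)"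
  proof (rule hyperbolic_area_above_graph[OF A])
    fix x y :: real assume x: "\<bar>x\<bar> \<le> 1/2" and ne: "y \<noteq> sqrt (1 - x\<^sup>2)"
    have "norm (Complex x y) \<ge> 1 \<longleftrightarrow> 1 - x\<^sup>2 \<le> y\<^sup>2" by (auto simp: cmod_def real_le_rsqrt)
    hence "0 < y \<Longrightarrow> norm (Complex x y) \<ge> 1 \<longleftrightarrow> sqrt (1 - x\<^sup>2) \<le> y"
      using real_le_lsqrt real_sqrt_le_iff[of "1 - x\<^sup>2" "y\<^sup>2"] by simp
    moreover have "\<not> sqrt (1 - x\<^sup>2) < y" if "\<not> 0 < y"
    proof -
      have "sqrt (1 - x\<^sup>2) > 0" using small[OF x] by simp
      thus ?thesis using that by linarith
    qed
    ultimately show "Complex x y \<in> ?A \<longleftrightarrow> sqrt (1 - x\<^sup>2) < y" using x ne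
      by (cases "0 < y") auto
  qed (use small in auto)
  also have "\<dots> = ennreal (arcsin (1/2) - arcsin (-1/2))"
  proof (rule nn_integral_FTC_Icc)
    fix x :: real assume "x \<in> {-1/2..1/2}"
    hence "-1 < x" "x < 1" by auto
    thus "(arcsin has_real_derivative 1 / sqrt (1 - x\<^sup>2)) (at x)"
      using DERIV_arcsin[of x] by (simp add: divide_inverse)
    have "\<bar>x\<bar> \<le> 1/2" using \<open>x \<in> {-1/2..1/2}\<close> by auto
    thus "0 \<le> 1 / sqrt (1 - x\<^sup>2)" using small[of x] by simp
  qed auto
  also have "arcsin (1/2) - arcsin (-1/2) = pi / 3"
  proof -
    have "arcsin (1/2) = pi / 6" using arcsin_sin[of "pi/6"] by (simp add: sin_30)
    moreover have "arcsin (-1/2) = - arcsin (1/2)" using arcsin_minus[of "1/2"] by simp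
    ultimately show ?thesis by simp
  qed
  finally have "(\<integral>\<^sup>+z\<in>?A. ennreal (1 / (Im z)\<^sup>2) \<partial>lborel) = ennreal (pi / 3)" .
  moreover have "fund_dom = ?A \<times> {u. norm u = 1}" by (auto simp: fund_dom_def T1H_def)
  ultimately have "emeasure haar_T1H fund_dom = ennreal (pi / 3) * ennreal (2 * pi)"
    using emeasure_haar_T1H_Times[OF A] by (simp only: Int_iff mem_Collect_eq)
  also have "\<dots> = ennreal (2 * pi\<^sup>2 / 3)"
    by (subst ennreal_mult[symmetric]) (auto simp: power2_eq_square)
  finally show ?thesis .
qed

text \<open>
  The primitive \<open>tan (x / 2)\<close> is the horocycle coordinate of a unit vector at angle \<open>x\<close>.
\<close>

lemma DERIV_tan_half:
  assumes "cos (x / 2) \<noteq> (0::real)"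
  shows "((\<lambda>x. tan (x / 2)) has_real_derivative 1 / (1 + cos x)) (at x)"
proof -
  have "1 + cos x = 2 * (cos (x / 2))\<^sup>2" using cos_double_cos[of "x / 2"] by simp
  thus ?thesis using assms
    by (auto intro!: derivative_eq_intros simp: inverse_eq_divide)
qed

lemma angular_integral:
  "(\<integral>\<^sup>+\<theta>. ennreal (1 / (1 + cos \<theta>)) * indicator {\<theta>. cos \<theta> > 0} \<theta> * indicator {0..<2 * pi} \<theta> \<partial>lborel) = 2"
proof -
  let ?f = "\<lambda>\<theta>::real. ennreal (1 / (1 + cos \<theta>))"
  have pos: "0 \<le> 1 / (1 + cos \<theta>)" for \<theta> :: real
    using cos_ge_minus_one[of \<theta>] by (intro divide_nonneg_nonneg) linarith+
  have part: "(\<integral>\<^sup>+\<theta>. ?f \<theta> * indicator {s..t} \<theta> \<partial>lborel) = ennreal (tan (t / 2) - tan (s / 2))"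
    if "s \<le> t" "\<And>\<theta>. s \<le> \<theta> \<Longrightarrow> \<theta> \<le> t \<Longrightarrow> cos (\<theta> / 2) \<noteq> 0" for s t :: real
  proof (rule nn_integral_FTC_Icc)
    fix x assume "x \<in> {s..t}"
    thus "((\<lambda>x. tan (x / 2)) has_real_derivative 1 / (1 + cos x)) (at x)"
      using that(2)[of x] by (intro DERIV_tan_half) auto
  qed (use that pos in auto)
  have one: "(\<integral>\<^sup>+\<theta>. ?f \<theta> * indicator {0..pi/2} \<theta> \<partial>lborel) = ennreal 1"
  proof (subst part)
    fix \<theta> :: real assume "0 \<le> \<theta>" "\<theta> \<le> pi / 2"
    hence "0 < cos (\<theta> / 2)" using pi_gt_zero by (intro cos_gt_zero_pi) linarith+
    thus "cos (\<theta> / 2) \<noteq> 0" by simp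
  qed (auto simp: tan_45)
  have two: "(\<integral>\<^sup>+\<theta>. ?f \<theta> * indicator {3*pi/2..2*pi} \<theta> \<partial>lborel) = ennreal 1"
  proof (subst part)
    fix \<theta> :: real assume "3 * pi / 2 \<le> \<theta>" "\<theta> \<le> 2 * pi"
    hence "0 < cos (\<theta> / 2 - pi)" using pi_gt_zero by (intro cos_gt_zero_pi) linarith+
    thus "cos (\<theta> / 2) \<noteq> 0" by (simp add: cos_diff)
  next
    have "tan (3 * pi / 2 / 2) = tan (- (pi / 4) + pi)" by (rule arg_cong) (simp add: field_simps)
    also have "\<dots> = - 1" by (simp only: tan_periodic_pi tan_minus tan_45)
    finally show "ennreal (tan (2 * pi / 2) - tan (3 * pi / 2 / 2)) = ennreal 1" by simp
  qed auto
  have cos_sign: "0 < cos \<theta> \<longleftrightarrow> \<theta> \<in> {0..pi/2} \<or> \<theta> \<in> {3*pi/2..2*pi}"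
    if \<theta>: "0 \<le> \<theta>" "\<theta> < 2 * pi" "\<theta> \<noteq> pi/2" "\<theta> \<noteq> 3*pi/2" for \<theta> :: real
  proof (cases "\<theta> < pi/2")
    case True
    hence "0 < cos \<theta>" using \<theta> by (intro cos_gt_zero_pi) linarith+
    thus ?thesis using True \<theta> by auto
  next
    case F1: False
    show ?thesis
    proof (cases "3*pi/2 < \<theta>")
      case True
      hence "0 < cos (\<theta> - 2 * pi)" using \<theta> by (intro cos_gt_zero_pi) linarith+
      thus ?thesis using True \<theta> by (simp add: cos_diff)
    next
      case False
      have "0 \<le> cos (\<theta> - pi)" using F1 False by (intro cos_ge_zero) linarith+
      hence "cos \<theta> \<le> 0" by (simp add: cos_diff)
      thus ?thesis using F1 False \<theta> by auto
    qed
  qed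
  have "(\<integral>\<^sup>+\<theta>. ?f \<theta> * indicator {\<theta>. cos \<theta> > 0} \<theta> * indicator {0..<2 * pi} \<theta> \<partial>lborel) =
      (\<integral>\<^sup>+\<theta>. ?f \<theta> * indicator {0..pi/2} \<theta> + ?f \<theta> * indicator {3*pi/2..2*pi} \<theta> \<partial>lborel)"
  proof (rule nn_integral_cong_AE)
    show "AE \<theta> in lborel. ?f \<theta> * indicator {\<theta>. cos \<theta> > 0} \<theta> * indicator {0..<2 * pi} \<theta> =
       ?f \<theta> * indicator {0..pi/2} \<theta> + ?f \<theta> * indicator {3*pi/2..2*pi} \<theta>"
      using AE_lborel_singleton[of "pi/2"] AE_lborel_singleton[of "3*pi/2"] AE_lborel_singleton[of "2*pi"]
    proof eventually_elim
      case (elim \<theta>)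
      show ?case
      proof (cases "0 \<le> \<theta> \<and> \<theta> < 2 * pi")
        case True
        have "\<not> (\<theta> \<in> {0..pi/2} \<and> \<theta> \<in> {3*pi/2..2*pi})"
          unfolding atLeastAtMost_iff using pi_gt_zero by linarith
        thus ?thesis using cos_sign[of \<theta>] elim True by (simp add: indicator_def)
      next
        case False
        hence "\<theta> \<notin> {0..<2*pi}" "\<theta> \<notin> {0..pi/2}" "\<theta> \<notin> {3*pi/2..2*pi}"
          using elim pi_gt_zero by auto
        thus ?thesis by simp
      qed
    qed
  qed
  also have "\<dots> = ennreal 1 + ennreal 1"
    by (subst nn_integral_add) (auto simp: one two)
  finally show ?thesis by simp
qed

text \<open>
  Over the angle \<open>\<theta>\<close> the box is the part of the strip above height \<open>1 + cos \<theta>\<close>, of area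
  \<open>1 / (1 + cos \<theta>)\<close>.
\<close>

lemma emeasure_haar_cusp_box:
  "emeasure haar_T1H (fund_dom \<inter> cusp_box) = 2"
proof -
  let ?L = "density lborel (\<lambda>z::complex. ennreal (1 / (Im z)\<^sup>2))"
  let ?R = "restrict_space lborel {0..<2 * pi}"
  let ?C = "distr ?R borel cis"
  let ?B = "fund_dom \<inter> cusp_box"
  let ?S = "\<lambda>t. {z. \<bar>Re z\<bar> \<le> 1/2 \<and> 1 + t < Im z}"
  have B_iff: "(z, u) \<in> ?B \<longleftrightarrow> norm u = 1 \<and> Re u > 0 \<and> z \<in> ?S (Re u)" for z u
  proof -
    have "1 \<le> norm z" if "1 < Im z" using that abs_Im_le_cmod[of z] by linarith
    thus ?thesis by (auto simp: fund_dom_def cusp_box_def T1H_def)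
  qed
  have S: "?S t \<in> sets borel" for t
  proof -
    have "?S t = {z. \<bar>Re z\<bar> \<le> 1/2} \<inter> {z. 1 + t < Im z}" by auto
    moreover have "closed {z. \<bar>Re z\<bar> \<le> 1/2}" "open {z. 1 + t < Im z}"
      by (intro closed_Collect_le open_Collect_less continuous_intros)+
    ultimately show ?thesis by (metis borel_closed borel_open sets.Int)
  qed
  have Im: "Im \<in> borel_measurable borel"
    by (intro borel_measurable_continuous_onI continuous_intros)
  have cis: "cis \<in> ?R \<rightarrow>\<^sub>M borel"
  proof (rule measurable_restrict_space1)
    have "continuous_on UNIV cis" by (intro continuous_intros)
    thus "cis \<in> lborel \<rightarrow>\<^sub>M borel" using borel_measurable_continuous_onI by simp
  qed
  have C: "emeasure ?C (space ?C) = ennreal (2 * pi)"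
    using cis by (simp add: emeasure_distr space_restrict_space emeasure_restrict_space)
  interpret C: finite_measure ?C by (rule finite_measureI) (simp only: C, simp)
  interpret L: sigma_finite_measure ?L
    using Im by (subst sigma_finite_measure.sigma_finite_iff_density_finite[OF lborel.sigma_finite_measure_axioms]) auto
  interpret LC: pair_sigma_finite ?L ?C ..
  have sets: "sets (?L \<Otimes>\<^sub>M ?C) = sets borel"
  proof -
    have "sets (?L \<Otimes>\<^sub>M ?C) = sets (borel \<Otimes>\<^sub>M (borel :: complex measure))"
      by (intro sets_pair_measure_cong) auto
    thus ?thesis unfolding borel_prod .
  qed
  have B: "?B \<in> sets borel"
  proof -
    have eq: "?B = {p. norm (snd p) = 1 \<and> \<bar>Re (fst p)\<bar> \<le> 1/2} \<inter> {p. Re (snd p) > 0 \<and> 1 + Re (snd p) < Im (fst p)}"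
    proof (rule set_eqI)
      fix p
      show "p \<in> ?B \<longleftrightarrow> p \<in> {p. norm (snd p) = 1 \<and> \<bar>Re (fst p)\<bar> \<le> 1/2} \<inter>
          {p. Re (snd p) > 0 \<and> 1 + Re (snd p) < Im (fst p)}"
        using B_iff[of "fst p" "snd p"] unfolding prod.collapse by blast
    qed
    have cl: "closed {p::complex \<times> complex. norm (snd p) = 1 \<and> \<bar>Re (fst p)\<bar> \<le> 1/2}"
      by (intro closed_Collect_conj closed_Collect_eq closed_Collect_le continuous_intros)
    have op: "open {p::complex \<times> complex. Re (snd p) > 0 \<and> 1 + Re (snd p) < Im (fst p)}"
      by (intro open_Collect_conj open_Collect_less continuous_intros)
    show ?thesis unfolding eq by (intro sets.Int borel_closed[OF cl] borel_open[OF op])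
  qed
  have B': "?B \<in> sets (?L \<Otimes>\<^sub>M ?C)" using B unfolding sets .
  have slice: "emeasure ?L ((\<lambda>z. (z, u)) -` ?B) = ennreal (1 / (1 + Re u)) * indicator {u. Re u > 0} u"
    if "norm u = 1" for u
  proof (cases "Re u > 0")
    case True
    have "(\<lambda>z. (z, u)) -` ?B = ?S (Re u)" using B_iff that True by auto
    hence "emeasure ?L ((\<lambda>z. (z, u)) -` ?B) = (\<integral>\<^sup>+z\<in>?S (Re u). ennreal (1 / (Im z)\<^sup>2) \<partial>lborel)"
      using S Im by (simp add: emeasure_density)
    also have "\<dots> = (\<integral>\<^sup>+x. ennreal (1 / (1 + Re u)) * indicator {-1/2..1/2::real} x \<partial>lborel)"
      using S True by (intro hyperbolic_area_above_graph) auto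
    also have "\<dots> = ennreal (1 / (1 + Re u))" by (subst nn_integral_cmult_indicator) auto
    finally show ?thesis using True by simp
  next
    case False
    hence "(\<lambda>z. (z, u)) -` ?B = {}" using B_iff by auto
    thus ?thesis using False by simp
  qed
  have "emeasure haar_T1H ?B = emeasure (?L \<Otimes>\<^sub>M ?C) ?B"
    unfolding haar_T1H_def
  proof (rule emeasure_restrict_space)
    have "T1H \<inter> space (?L \<Otimes>\<^sub>M ?C) = T1H" by (simp add: space_pair_measure)
    thus "T1H \<inter> space (?L \<Otimes>\<^sub>M ?C) \<in> sets (?L \<Otimes>\<^sub>M ?C)"
      unfolding sets using T1H_borel by (simp only:)
  qed (auto simp: fund_dom_def)
  also have "\<dots> = (\<integral>\<^sup>+u. emeasure ?L ((\<lambda>z. (z, u)) -` ?B) \<partial>?C)"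
    by (rule LC.emeasure_pair_measure_alt2[OF B'])
  also have "\<dots> = (\<integral>\<^sup>+\<theta>. emeasure ?L ((\<lambda>z. (z, cis \<theta>)) -` ?B) \<partial>?R)"
    by (rule nn_integral_distr[OF cis]) (use LC.measurable_emeasure_Pair2[OF B'] in simp)
  also have "\<dots> = (\<integral>\<^sup>+\<theta>. ennreal (1 / (1 + cos \<theta>)) * indicator {\<theta>. cos \<theta> > 0} \<theta> \<partial>?R)"
    using slice[of "cis _"] by (intro nn_integral_cong) (auto simp: indicator_def)
  also have "\<dots> = (\<integral>\<^sup>+\<theta>. ennreal (1 / (1 + cos \<theta>)) * indicator {\<theta>. cos \<theta> > 0} \<theta> *
      indicator {0..<2 * pi} \<theta> \<partial>lborel)"
    by (rule nn_integral_restrict_space) auto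
  also have "\<dots> = 2" by (rule angular_integral)
  finally show ?thesis .
qed

lemma haar_M_cusp_set: "measure haar_M cusp_set = 3 / pi\<^sup>2"
proof -
  have orb: "orbit \<in> uniform_measure haar_T1H fund_dom \<rightarrow>\<^sub>M M_borel"
    using measurable_orbit by (simp cong: measurable_cong_sets)
  have pre: "orbit -` cusp_set \<inter> space haar_T1H \<in> sets haar_T1H"
    using measurable_sets[OF measurable_orbit cusp_set_measurable] .
  have eq: "fund_dom \<inter> (orbit -` cusp_set \<inter> space haar_T1H) = fund_dom \<inter> cusp_box"
    using orbit_in_cusp_set_fund_dom_iff by (auto simp: space_haar_T1H fund_dom_def)
  have "measure haar_M cusp_set =
      measure (uniform_measure haar_T1H fund_dom) (orbit -` cusp_set \<inter> space haar_T1H)"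
    unfolding haar_M_def using measure_distr[OF orb cusp_set_measurable] by simp
  also have "\<dots> = measure haar_T1H (fund_dom \<inter> cusp_box) / measure haar_T1H fund_dom"
    using pre emeasure_fund_dom by (simp add: measure_uniform_measure eq)
  also have "\<dots> = 3 / pi\<^sup>2"
    by (simp add: measure_def emeasure_haar_cusp_box emeasure_haar_fund_dom)
  finally show ?thesis .
qed

section \<open>Discrepancy of long horocycles\<close>

lemma three_over_pi_squared: "0 < 3 / pi\<^sup>2" "3 / pi\<^sup>2 < 1 / 3"
proof -
  have "9 < pi\<^sup>2" using power_strict_mono[of 3 pi 2] pi_gt3 by simp
  thus "0 < 3 / pi\<^sup>2" "3 / pi\<^sup>2 < 1 / 3" by (auto simp: field_simps)
qed

text \<open>
  With \<open>X = 1 / sqrt (2 * y)\<close> the denominators admitted are those less than \<open>X\<close>, and the crossing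
  times add up to \<open>totient_sum N / X\<^sup>2\<close> with \<open>N < X \<le> N + 1\<close>. Replacing \<open>N\<close> by \<open>X\<close> in the quadratic
  main term costs \<open>O(X)\<close>, no more than the error in Mertens' estimate.
\<close>

lemma horocycle_discrepancy_upper:
  assumes y: "0 < y" "y \<le> 1/2"
  shows "\<bar>measure (horocycle_measure y) cusp_set - 3 / pi\<^sup>2\<bar> \<le> 12 * y powr (1/2) * \<bar>ln y\<bar>"
proof -
  define C where "C = 3 / pi\<^sup>2"
  have C: "0 < C" "C < 1/3" unfolding C_def by (rule three_over_pi_squared)+
  define X where "X = 1 / sqrt (2 * y)"
  have X2: "X\<^sup>2 = 1 / (2 * y)" using y by (simp add: X_def power_divide)
  have X1: "X \<ge> 1" using y by (simp add: X_def real_le_lsqrt)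
  define N where "N = nat (\<lceil>X\<rceil> - 1)"
  have NX: "real N < X" "X \<le> real N + 1"
    using X1 unfolding N_def by linarith+
  have "2 * (real c)\<^sup>2 * y < 1 \<longleftrightarrow> c \<le> N" for c
  proof -
    have "2 * (real c)\<^sup>2 * y < 1 \<longleftrightarrow> (real c)\<^sup>2 < X\<^sup>2" using y by (simp add: X2 field_simps)
    also have "\<dots> \<longleftrightarrow> real c < X"
      using X1 power_mono_iff[of X "real c" 2] by linarith
    also have "\<dots> \<longleftrightarrow> c \<le> N" using NX by linarith
    finally show ?thesis .
  qed
  hence "measure (horocycle_measure y) cusp_set = 2 * y * totient_sum N"
    by (intro horocycle_measure_cusp_set y)
  also have "\<dots> = totient_sum N / X\<^sup>2" using y by (simp add: X2)
  finally have "\<bar>measure (horocycle_measure y) cusp_set - C\<bar> = \<bar>(totient_sum N - C * X\<^sup>2) / X\<^sup>2\<bar>"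
    using X1 by (simp add: diff_divide_distrib)
  also have "\<dots> = \<bar>totient_sum N - C * X\<^sup>2\<bar> / X\<^sup>2" by simp
  also have "\<bar>totient_sum N - C * X\<^sup>2\<bar> \<le> X * (3 + 2 * ln X)"
  proof -
    have "\<bar>totient_sum N - C * (real N)\<^sup>2\<bar> \<le> 2 * X * (1 + ln X)"
    proof (cases "N = 0")
      case True
      thus ?thesis using X1 by (simp add: totient_sum_def)
    next
      case False
      have "\<bar>totient_sum N - C * (real N)\<^sup>2\<bar> \<le> 2 * real N * (1 + ln (real N))"
        unfolding C_def using False by (intro totient_sum_asymptotics) simp
      also have "\<dots> \<le> 2 * X * (1 + ln X)" using False NX X1 by (intro mult_mono) auto
      finally show ?thesis .
    qed
    moreover have "0 \<le> C * (X\<^sup>2 - (real N)\<^sup>2)" "C * (X\<^sup>2 - (real N)\<^sup>2) \<le> X"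
    proof -
      have "(real N)\<^sup>2 \<le> X\<^sup>2" using NX by (intro power_mono) auto
      thus "0 \<le> C * (X\<^sup>2 - (real N)\<^sup>2)" using C by simp
      have "X\<^sup>2 \<le> (real N + 1)\<^sup>2" using NX X1 by (intro power_mono) auto
      also have "\<dots> = (real N)\<^sup>2 + 2 * real N + 1" by (simp add: power2_eq_square algebra_simps)
      finally have "X\<^sup>2 - (real N)\<^sup>2 \<le> 3 * X" using NX X1 by linarith
      hence "C * (X\<^sup>2 - (real N)\<^sup>2) \<le> C * (3 * X)" using C by (intro mult_left_mono) auto
      also have "\<dots> \<le> 1/3 * (3 * X)" using C X1 by (intro mult_right_mono) auto
      finally show "C * (X\<^sup>2 - (real N)\<^sup>2) \<le> X" by simp
    qed
    moreover have "C * X\<^sup>2 = C * (real N)\<^sup>2 + C * (X\<^sup>2 - (real N)\<^sup>2)"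
      "X * (3 + 2 * ln X) = 2 * X * (1 + ln X) + X" by (simp_all add: algebra_simps)
    ultimately show ?thesis by linarith
  qed
  hence "\<bar>totient_sum N - C * X\<^sup>2\<bar> / X\<^sup>2 \<le> X * (3 + 2 * ln X) / X\<^sup>2"
    by (intro divide_right_mono) auto
  also have "\<dots> = sqrt (2 * y) * (3 + 2 * ln X)" using y by (simp add: X_def field_simps)
  also have "\<dots> \<le> (2 * y powr (1/2)) * (6 * \<bar>ln y\<bar>)"
  proof (intro mult_mono)
    show "sqrt (2 * y) \<le> 2 * y powr (1/2)"
      using y sqrt2_less_2 by (simp add: powr_half_sqrt real_sqrt_mult)
    have "ln y \<le> ln (1/2)" using y by simp
    hence l: "ln y \<le> - (2/3)" using ln2_ge_two_thirds by (simp add: ln_div)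
    have "ln X = - (1/2) * (ln 2 + ln y)" using y by (simp add: X_def ln_div ln_sqrt ln_mult)
    hence "2 * ln X = - ln 2 - ln y" by (simp add: field_simps)
    moreover have "\<bar>ln y\<bar> = - ln y" using l by simp
    ultimately show "3 + 2 * ln X \<le> 6 * \<bar>ln y\<bar>" using l ln2_ge_two_thirds by simp
    show "0 \<le> 3 + 2 * ln X" using X1 by simp
  qed (use y in auto)
  finally show ?thesis by (simp add: C_def)
qed

text \<open>
  Between the heights \<open>1 / (2 * p\<^sup>2)\<close> and \<open>1 / (2 * (p + 1)\<^sup>2)\<close>, for a prime \<open>p\<close>, the \<open>p - 1\<close> fractions
  with denominator \<open>p\<close> are added to the count at once, while the quadratic main term grows by only
  \<open>3 / pi\<^sup>2 * (2 * p + 1)\<close>, about \<open>0.61 * p\<close>. So the error at one of the two heights is at least of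
  order \<open>p\<close>.
\<close>

lemma horocycle_discrepancy_lower:
  "\<exists>n\<ge>m. \<bar>measure (horocycle_measure (1 / (2 * (real n)\<^sup>2))) cusp_set - 3 / pi\<^sup>2\<bar> \<ge> 1 / (24 * real n)"
proof -
  define C where "C = 3 / pi\<^sup>2"
  have C: "0 < C" "C < 1/3" unfolding C_def by (rule three_over_pi_squared)+
  \<comment> \<open>\<open>n - 1\<close>, because at height \<open>1 / (2 * n\<^sup>2)\<close> only denominators strictly below \<open>n\<close> are admitted\<close>
  define E where "E = (\<lambda>n. totient_sum (n - 1) - C * (real n)\<^sup>2)"
  \<comment> \<open>\<open>p \<ge> 8\<close> makes \<open>p / 3 - 4 / 3\<close>, a lower bound for the jump of the error, at least \<open>p / 6\<close>\<close>
  obtain p where p: "prime p" "p > max m 8" using bigger_prime by blast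
  have "totient_sum p = totient_sum (p - 1) + (real p - 1)"
    using p totient_prime[OF p(1)] by (cases p) (auto simp: totient_sum_def)
  hence "E (p + 1) - E p = real p - 1 - C * (2 * real p + 1)"
    by (simp add: E_def power2_eq_square algebra_simps)
  moreover have "C * (2 * real p + 1) \<le> 1/3 * (2 * real p + 1)" using C by (intro mult_right_mono) auto
  hence "real p - 1 - C * (2 * real p + 1) \<ge> real p - 1 - (2 * real p + 1) / 3" by simp
  moreover have "real p - 1 - (2 * real p + 1) / 3 = real p / 3 - 4 / 3" by (simp add: field_simps)
  moreover have "8 \<le> real p" using p by simp
  ultimately have "real p / 6 \<le> E (p + 1) - E p" by linarith
  hence "real p / 12 \<le> \<bar>E (p + 1)\<bar> \<or> real p / 12 \<le> \<bar>E p\<bar>"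
    by (intro disjCI) linarith
  then obtain n where n: "n \<ge> p" "n \<le> p + 1" "real p / 12 \<le> \<bar>E n\<bar>"
    by (metis le_add1 le_refl)
  have n1: "real n \<ge> 1" and En: "real n / 24 \<le> \<bar>E n\<bar>" using n p by linarith+
  let ?y = "1 / (2 * (real n)\<^sup>2)"
  have "2 * (real c)\<^sup>2 * ?y < 1 \<longleftrightarrow> c \<le> n - 1" if "c \<ge> 1" for c
  proof -
    have "2 * (real c)\<^sup>2 * ?y < 1 \<longleftrightarrow> (real c)\<^sup>2 < (real n)\<^sup>2" using n1 by (simp add: field_simps)
    also have "\<dots> \<longleftrightarrow> c\<^sup>2 < n\<^sup>2" by (metis of_nat_less_iff of_nat_power)
    also have "\<dots> \<longleftrightarrow> c \<le> n - 1" using n1 power_mono_iff[of n c 2] by linarith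
    finally show ?thesis .
  qed
  hence "measure (horocycle_measure ?y) cusp_set = 2 * ?y * totient_sum (n - 1)"
    using n1 by (intro horocycle_measure_cusp_set) auto
  hence "measure (horocycle_measure ?y) cusp_set - C = E n / (real n)\<^sup>2"
    using n1 by (simp add: E_def field_simps)
  hence "\<bar>measure (horocycle_measure ?y) cusp_set - C\<bar> = \<bar>E n\<bar> / (real n)\<^sup>2" by simp
  also have "\<dots> \<ge> (real n / 24) / (real n)\<^sup>2" using En by (intro divide_right_mono) auto
  also have "(real n / 24) / (real n)\<^sup>2 = 1 / (24 * real n)" using n1 by (simp add: power2_eq_square)
  finally show ?thesis using n p unfolding C_def by (intro exI[of _ n]) auto
qed

text \<open>
  At the heights \<open>y = 1 / (2 * n\<^sup>2)\<close> of the preceding lemma, the discrepancy is at least \<open>1 / (24 * n)\<close>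
  and \<open>y powr (- \<alpha>)\<close> at least \<open>n powr (2 * \<alpha>)\<close>; their product grows like \<open>n powr (2 * \<alpha> - 1)\<close>.
\<close>

lemma Limsup_horocycle_discrepancy:
  assumes "\<alpha> > 1/2"
  shows "Limsup (at_right 0) (\<lambda>y. ereal
    (\<bar>measure (horocycle_measure y) cusp_set - 3 / pi\<^sup>2\<bar> * y powr (- \<alpha>))) = \<infinity>"
    (is "Limsup _ ?f = _")
proof (rule ccontr)
  assume "Limsup (at_right 0) ?f \<noteq> \<infinity>"
  then obtain B where "Limsup (at_right 0) ?f < ereal B"
    by (metis ereal_infty_less(1) less_PInf_Ex_of_nat)
  hence "eventually (\<lambda>y. ?f y < ereal B) (at_right 0)" by (rule Limsup_lessD)
  then obtain b where b: "b > 0" "\<And>y. 0 < y \<Longrightarrow> y < b \<Longrightarrow> ?f y < ereal B"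
    unfolding eventually_at_right_field by auto
  define \<beta> where "\<beta> = 2 * \<alpha> - 1"
  have \<beta>: "\<beta> > 0" using assms by (simp add: \<beta>_def)
  \<comment> \<open>large enough for both \<open>1 / (2 * n\<^sup>2) < b\<close> and \<open>n powr \<beta> > 24 * \<bar>B\<bar>\<close> once \<open>n \<ge> R\<close>\<close>
  define R where "R = (24 * \<bar>B\<bar> + 1) powr (1 / \<beta>) + 1 / b + 1"
  obtain m where "R \<le> real m" using real_arch_simple by blast
  obtain n where n: "n \<ge> m" and
    low: "\<bar>measure (horocycle_measure (1 / (2 * (real n)\<^sup>2))) cusp_set - 3 / pi\<^sup>2\<bar> \<ge> 1 / (24 * real n)"
    using horocycle_discrepancy_lower by blast
  have Rn: "R \<le> real n" using \<open>R \<le> real m\<close> n by linarith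
  have R: "(24 * \<bar>B\<bar> + 1) powr (1 / \<beta>) \<le> real n" "1 / b < real n" "1 \<le> real n"
    using Rn b(1) powr_ge_zero[of "24 * \<bar>B\<bar> + 1" "1 / \<beta>"] divide_pos_pos[OF zero_less_one b(1)]
    unfolding R_def by linarith+
  define y where "y = 1 / (2 * (real n)\<^sup>2)"
  have y0: "y > 0" using R by (simp add: y_def)
  have "real n * 1 \<le> real n * real n" using R by (intro mult_left_mono) auto
  hence "1 / b < 2 * (real n)\<^sup>2" using R unfolding power2_eq_square by linarith
  hence yb: "y < b" using b(1) R by (simp add: y_def field_simps)
  have "24 * \<bar>B\<bar> + 1 = ((24 * \<bar>B\<bar> + 1) powr (1 / \<beta>)) powr \<beta>" using \<beta> by (simp add: powr_powr)
  also have "\<dots> \<le> real n powr \<beta>" using R \<beta> by (intro powr_mono2) auto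
  finally have big: "24 * \<bar>B\<bar> < real n powr \<beta>" by simp
  have "real n powr \<beta> = real n powr (2 * \<alpha>) / real n" using R by (simp add: \<beta>_def powr_diff)
  also have "real n powr (2 * \<alpha>) = (real n powr 2) powr \<alpha>" by (simp only: powr_powr)
  also have "\<dots> \<le> (2 * (real n)\<^sup>2) powr \<alpha>" using R assms by (intro powr_mono2) auto
  also have "\<dots> = y powr (- \<alpha>)" using R by (simp add: y_def powr_minus powr_divide field_simps)
  finally have "real n powr \<beta> \<le> y powr (- \<alpha>) / real n" using R by (simp add: divide_right_mono)
  hence "B < 1 / (24 * real n) * y powr (- \<alpha>)" using big by (simp add: field_simps)
  also have "\<dots> \<le> \<bar>measure (horocycle_measure y) cusp_set - 3 / pi\<^sup>2\<bar> * y powr (- \<alpha>)"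
    using low by (intro mult_right_mono) (auto simp: y_def)
  finally show False using b(2)[OF y0 yb] by simp
qed

theorem mainTheorem1:
  shows "\<exists>U. openin M_top U \<and>
    (\<exists>K>0. \<forall>y::real. 0 < y \<and> y \<le> 1/2 \<longrightarrow>
       \<bar>(\<integral>p. indicator U p \<partial>horocycle_measure y) - (\<integral>p. indicator U p \<partial>haar_M)\<bar>
         \<le> K * y powr (1/2) * \<bar>ln y\<bar>) \<and>
    (\<forall>\<alpha>::real. \<alpha> > 1/2 \<longrightarrow>
       Limsup (at_right 0) (\<lambda>y::real. ereal
         (\<bar>(\<integral>p. indicator U p \<partial>horocycle_measure y) - (\<integral>p. indicator U p \<partial>haar_M)\<bar>
            * y powr (- \<alpha>))) = \<infinity>)"
proof (intro exI[of _ cusp_set] conjI exI[of _ 12] allI impI)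
  have sub: "cusp_set \<inter> M_space = cusp_set"
    using openin_subset[OF openin_cusp_set] by (auto simp: topspace_M_top)
  have horo: "(\<integral>p. indicator cusp_set p \<partial>horocycle_measure y) = measure (horocycle_measure y) cusp_set"
    for y by (simp add: horocycle_measure_def space_M_borel sub)
  have haar: "(\<integral>p. indicator cusp_set p \<partial>haar_M) = 3 / pi\<^sup>2"
    using haar_M_cusp_set by (simp add: haar_M_def space_M_borel sub)
  show "openin M_top cusp_set" by (rule openin_cusp_set)
  show "\<bar>(\<integral>p. indicator cusp_set p \<partial>horocycle_measure y) - (\<integral>p. indicator cusp_set p \<partial>haar_M)\<bar>
      \<le> 12 * y powr (1/2) * \<bar>ln y\<bar>" if "0 < y \<and> y \<le> 1/2" for y
    unfolding horo haar using horocycle_discrepancy_upper that by blast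
  show "Limsup (at_right 0) (\<lambda>y::real. ereal
      (\<bar>(\<integral>p. indicator cusp_set p \<partial>horocycle_measure y) - (\<integral>p. indicator cusp_set p \<partial>haar_M)\<bar>
        * y powr (- \<alpha>))) = \<infinity>" if "\<alpha> > 1/2" for \<alpha>
    unfolding horo haar by (rule Limsup_horocycle_discrepancy[OF that])
qed simp

end
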